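(* Let $M\subseteq \mathbb{C}^n$ be a complex domain (open and connected) such that $M\cap\{z_j=0\}\neq\emptyset$ for every $j=1,\dots,n$, and let $\omega_\Phi=\frac{i}{2}\partial\bar\partial\Phi$ be a rotation invariant Kähler form on $M$ with associated function $\tilde\Phi:\tilde M\to\mathbb{R}$. Then: (i) there exists a uniquely determined special symplectic immersion $\Psi_0:(M,\omega_\Phi)\to(\mathbb{C}^n,\omega_0)$ (resp. $\Psi_{hyp}:(M,\omega_\Phi)\to(\mathbb{C}H^n,\omega_{hyp})$) if and only if $$\frac{\partial\tilde\Phi}{\partial x_k}\geq 0,\quad k=1,\dots,n;$$ (ii) there exists a uniquely determined special symplectic immersion $\Psi_{FS}:(M,\omega_\Phi)\to(\mathbb{C}^n,\omega_{FS})$ if and only if $$\frac{\partial\tilde\Phi}{\partial x_k}\geq 0,\quad k=1,\dots,n,\qquad\text{and}\qquad \sum_{j=1}^n\frac{\partial\tilde\Phi}{\partial x_j}x_j<1.$$ Moreover, assume that $0\in M$. If the condition in (i) (resp. the condition in (ii)) is satisfied, then $\Psi_0$ (resp. $\Psi_{FS}$) is a global symplectomorphism onto $\mathbb{C}^n$ (and hence $i\circ\Psi_{FS}:M\to\mathbb{C}P^n$ is a symplectic embedding, where $i$ is the inclusion of the affine chart) if and only if $$\frac{\partial\tilde\Phi}{\partial x_k}>0,\quad k=1,\dots,n,$$ and $$\lim_{x\to\partial M}\sum_{j=1}^n\frac{\partial\tilde\Phi}{\partial x_j}x_j=+\infty\qquad\Big(\text{resp. }\lim_{x\to\partial M}\sum_{j=1}^n\frac{\partial\tilde\Phi}{\partial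 x_j}x_j=1\Big).$$
   Context: Let $z_1,\dots,z_n$ be the standard complex coordinates on $\mathbb{C}^n$. For a domain $M\subseteq\mathbb{C}^n$ set $\tilde M=\{x=(x_1,\dots,x_n)\in\mathbb{R}^n:\ x_j=|z_j|^2,\ z\in M\}$. A Kähler form $\omega_\Phi=\frac{i}{2}\partial\bar\partial\Phi$ on $M$, with $\Phi:M\to\mathbb{R}$ smooth, is called rotation invariant with associated function $\tilde\Phi$ if $\tilde\Phi:\tilde M\to\mathbb{R}$ is smooth and $\Phi(z_1,\dots,z_n)=\tilde\Phi(|z_1|^2,\dots,|z_n|^2)$. A smooth map $\Psi:M\to S$ between domains of $\mathbb{C}^n$ is called special if it has the form $\Psi(z)=(\tilde\psi_1(x)z_1,\dots,\tilde\psi_n(x)z_n)$, $x_j=|z_j|^2$, for some real functions $\tilde\psi_j:\tilde M\to\mathbb{R}$. It is symplectic if it pulls back the target form to $\omega_\Phi$. Here $\omega_0=\frac{i}{2}\sum_j dz_j\wedge d\bar z_j$ is the flat form on $\mathbb{C}^n$; $\mathbb{C}H^n=\{z\in\mathbb{C}^n:\sum_j|z_j|^2<1\}$ with $\omega_{hyp}=-\frac{i}{2}\partial\bar\partial\log(1-\sum_j|z_j|^2)$; $\omega_{FS}=\frac{i}{2}\partial\bar\partial\log(1+\sum_j|z_j|^2)$ is the Fubini–Study form on $\mathbb{C}^n$ viewed as the affine chart $Z_0\neq0$ of $\mathbb{C}P^n$ (with $z_j=Z_j/Z_0$), and $i:\mathbb{C}^n\hookrightarrow\mathbb{C}P^n$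 is this inclusion. For a rotation invariant continuous $F:M\to\mathbb{R}$ with $F(z)=\tilde F(|z_1|^2,\dots,|z_n|^2)$, the notation $\lim_{x\to\partial M}\tilde F(x)=l\in\mathbb{R}\cup\{\infty\}$ means that $\tilde F(x)\to l$ whenever $\|x\|\to+\infty$ or $z\to z_0\in\partial M$ (the boundary of $M$ in $\mathbb{C}^n$).
   Formalization: "Uniquely determined" is proved as unique up to a constant sign in each coordinate, since literal uniqueness fails (z and −z are both special symplectic immersions of flat C^n); the parenthetical consequence that i∘Ψ_FS is a symplectic embedding into CP^n is not stated. *)

theory Defs
  imports "HOL-Analysis.Analysis"
begin

text \<open>C^k via iterated directional (Frechet) derivatives; intended for open sets S.\<close>
fun Ck_on :: "nat \<Rightarrow> 'a::real_normed_vector set \<Rightarrow> ('a \<Rightarrow> 'b::real_normed_vector) \<Rightarrow> bool" where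
  "Ck_on 0 S f = continuous_on S f"
| "Ck_on (Suc k) S f =
     ((\<forall>x\<in>S. f differentiable (at x)) \<and>
      (\<forall>v. Ck_on k S (\<lambda>x. frechet_derivative f (at x) v)))"

definition smooth_on :: "'a::real_normed_vector set \<Rightarrow> ('a \<Rightarrow> 'b::real_normed_vector) \<Rightarrow> bool" where
  "smooth_on S f \<longleftrightarrow> (\<forall>k. Ck_on k S f)"

definition sqmod :: "complex^'n \<Rightarrow> real^'n" where
  "sqmod z = (\<chi> j. (cmod (z $ j))\<^sup>2)"

definition tildeM :: "(complex^'n) set \<Rightarrow> (real^'n) set" where
  "tildeM M = sqmod ` M"

definition Jmul :: "complex^'n \<Rightarrow> complex^'n" where
  "Jmul u = (\<chi> j. \<i> * u $ j)"

definition hess :: "(complex^'n \<Rightarrow> real) \<Rightarrow> complex^'n \<Rightarrow> complex^'n \<Rightarrow> complex^'n \<Rightarrow> real" where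
  "hess P z u v = frechet_derivative (\<lambda>w. frechet_derivative P (at w) u) (at z) v"

text \<open>The real 2-form (i/2) d dbar P at z evaluated on tangent vectors u v:
  with Levi form L(u,v) = sum_{j,k} P_{j kbar} u_j conj(v_k), one has
  (i/2) d dbar P (u,v) = - Im L(u,v) = (D^2 P(Ju,v) - D^2 P(u,Jv)) / 4.\<close>
definition kform :: "(complex^'n \<Rightarrow> real) \<Rightarrow> complex^'n \<Rightarrow> complex^'n \<Rightarrow> complex^'n \<Rightarrow> real" where
  "kform P z u v = (hess P z (Jmul u) v - hess P z u (Jmul v)) / 4"

text \<open>Phi is a Kahler potential on M: smooth and (i/2) d dbar Phi positive definite
  (closedness is automatic for a potential).\<close>
definition kahler_potential :: "(complex^'n) set \<Rightarrow> (complex^'n \<Rightarrow> real) \<Rightarrow> bool" where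
  "kahler_potential M P \<longleftrightarrow> smooth_on M P \<and>
     (\<forall>z\<in>M. \<forall>u. u \<noteq> 0 \<longrightarrow> kform P z u (Jmul u) > 0)"

definition rot_inv_kahler :: "(complex^'n) set \<Rightarrow> (real^'n \<Rightarrow> real) \<Rightarrow> bool" where
  "rot_inv_kahler M Phit \<longleftrightarrow>
     (\<exists>U. open U \<and> tildeM M \<subseteq> U \<and> smooth_on U Phit) \<and>
     kahler_potential M (\<lambda>z. Phit (sqmod z))"

definition pd :: "(real^'n \<Rightarrow> real) \<Rightarrow> 'n \<Rightarrow> real^'n \<Rightarrow> real" where
  "pd F k x = frechet_derivative F (at x) (axis k 1)"

definition flat_pot :: "complex^'n \<Rightarrow> real" where
  "flat_pot z = (norm z)\<^sup>2"

definition hyp_pot :: "complex^'n \<Rightarrow> real" where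
  "hyp_pot z = - ln (1 - (norm z)\<^sup>2)"

definition FS_pot :: "complex^'n \<Rightarrow> real" where
  "FS_pot z = ln (1 + (norm z)\<^sup>2)"

definition special_map :: "(complex^'n) set \<Rightarrow> (complex^'n \<Rightarrow> complex^'n) \<Rightarrow> bool" where
  "special_map M Psi \<longleftrightarrow> smooth_on M Psi \<and>
     (\<exists>psi :: 'n \<Rightarrow> real^'n \<Rightarrow> real.
        \<forall>z\<in>M. Psi z = (\<chi> j. complex_of_real (psi j (sqmod z)) * z $ j))"

definition immersion_on :: "(complex^'n) set \<Rightarrow> (complex^'n \<Rightarrow> complex^'n) \<Rightarrow> bool" where
  "immersion_on M Psi \<longleftrightarrow> (\<forall>z\<in>M. inj (frechet_derivative Psi (at z)))"

definition symplectic_on ::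
  "(complex^'n) set \<Rightarrow> (complex^'n \<Rightarrow> real) \<Rightarrow> (complex^'n \<Rightarrow> real) \<Rightarrow> (complex^'n \<Rightarrow> complex^'n) \<Rightarrow> bool" where
  "symplectic_on M P G Psi \<longleftrightarrow>
     (\<forall>z\<in>M. \<forall>u v. kform G (Psi z) (frechet_derivative Psi (at z) u) (frechet_derivative Psi (at z) v)
                   = kform P z u v)"

definition ssi :: "(complex^'n) set \<Rightarrow> (complex^'n \<Rightarrow> real) \<Rightarrow> (complex^'n) set \<Rightarrow> (complex^'n \<Rightarrow> real)
                    \<Rightarrow> (complex^'n \<Rightarrow> complex^'n) \<Rightarrow> bool" where
  "ssi M P S G Psi \<longleftrightarrow> special_map M Psi \<and> Psi ` M \<subseteq> S \<and> immersion_on M Psi \<and> symplectic_on M P G Psi"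

definition unique_ssi :: "(complex^'n) set \<Rightarrow> (complex^'n \<Rightarrow> real) \<Rightarrow> (complex^'n) set \<Rightarrow> (complex^'n \<Rightarrow> real) \<Rightarrow> bool" where
  "unique_ssi M P S G \<longleftrightarrow> (\<exists>Psi. ssi M P S G Psi) \<and>
     (\<forall>Psi Psi'. ssi M P S G Psi \<and> ssi M P S G Psi' \<longrightarrow>
        (\<exists>eps :: real^'n. (\<forall>j. eps $ j = 1 \<or> eps $ j = -1) \<and>
           (\<forall>z\<in>M. Psi' z = (\<chi> j. complex_of_real (eps $ j) * Psi z $ j))))"

text \<open>Psi : M -> C^n is a global symplectomorphism onto C^n (the symplectic property being
  given separately): a bijection M -> C^n with smooth inverse.\<close>
definition diffeo_onto_Cn :: "(complex^'n) set \<Rightarrow> (complex^'n \<Rightarrow> complex^'n) \<Rightarrow> bool" where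
  "diffeo_onto_Cn M Psi \<longleftrightarrow> bij_betw Psi M UNIV \<and>
     (\<exists>g. smooth_on UNIV g \<and> (\<forall>z\<in>M. g (Psi z) = z) \<and> (\<forall>w. Psi (g w) = w))"

definition lim_bdry :: "(complex^'n) set \<Rightarrow> (complex^'n \<Rightarrow> real) \<Rightarrow> real \<Rightarrow> bool" where
  "lim_bdry M F l \<longleftrightarrow> (F \<longlongrightarrow> l) (inf at_infinity (principal M)) \<and>
     (\<forall>z0\<in>frontier M. (F \<longlongrightarrow> l) (at z0 within M))"

definition lim_bdry_infty :: "(complex^'n) set \<Rightarrow> (complex^'n \<Rightarrow> real) \<Rightarrow> bool" where
  "lim_bdry_infty M F \<longleftrightarrow> filterlim F at_top (inf at_infinity (principal M)) \<and>
     (\<forall>z0\<in>frontier M. filterlim F at_top (at z0 within M))"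

definition euler_sum :: "(real^'n \<Rightarrow> real) \<Rightarrow> real^'n \<Rightarrow> real" where
  "euler_sum F x = (\<Sum>j\<in>UNIV. pd F j x * x $ j)"

end

theory Submission
  imports Defs
begin

text \<open>
  The rotation of the \<open>k\<close>-th coordinate is Hamiltonian for a rotation invariant form, with Hamiltonian
  \<open>f\<^sub>k |z\<^sub>k|\<^sup>2\<close> up to a factor, where \<open>f\<^sub>k = \<partial>\<Phi>/\<partial>x\<^sub>k\<close>. A special map intertwines these rotations, so a
  special symplectic map pulls back the Hamiltonians of the target to those of the source up to constants,
  which vanish because \<open>M\<close> meets \<open>z\<^sub>k = 0\<close>. For the target potential \<open>ln (1 + c |w|\<^sup>2) / c\<close>
  (read as \<open>|w|\<^sup>2\<close> if \<open>c = 0\<close>) this says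
  \<open>|\<Psi>\<^sub>k|\<^sup>2 / (1 + c |\<Psi>|\<^sup>2) = f\<^sub>k |z\<^sub>k|\<^sup>2\<close>; hence \<open>\<Psi>\<^sub>k = \<plusminus> sqrt (f\<^sub>k / (1 - c E)) z\<^sub>k\<close> with
  \<open>E = \<Sum>\<^sub>k f\<^sub>k |z\<^sub>k|\<^sup>2\<close>, and the sign is constant since \<open>M\<close> minus a complex hyperplane is connected.
  Positivity of the Kaehler form upgrades \<open>f\<^sub>k \<ge> 0\<close> to \<open>f\<^sub>k > 0\<close>, so this formula is smooth.
  The limit condition says that \<open>\<Psi>\<close> is proper. A proper local diffeomorphism whose fibre over \<open>0\<close> is \<open>{0}\<close>
  is bijective, because the set of points with two preimages is open and closed.
\<close>

section \<open>Differentiability classes\<close>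

lemma Ck_on_cong:
  assumes "open S" "\<And>x. x \<in> S \<Longrightarrow> f x = g x"
  shows "Ck_on k S f \<longleftrightarrow> Ck_on k S g"
  using assms(2)
proof (induction k arbitrary: f g)
  case 0
  then show ?case by (auto cong: continuous_on_cong)
next
  case (Suc k)
  have 1: "f differentiable at x \<longleftrightarrow> g differentiable at x" if "x \<in> S" for x
    unfolding differentiable_def
    using has_derivative_transform_within_open[OF _ \<open>open S\<close> that] Suc.prems by metis
  have 2: "frechet_derivative f (at x) v = frechet_derivative g (at x) v" if "x \<in> S" for x v
    unfolding frechet_derivative_def
    using has_derivative_transform_within_open[OF _ \<open>open S\<close> that] Suc.prems by metis
  show ?case
    using 1 Suc.IH[of "\<lambda>x. frechet_derivative f (at x) _" "\<lambda>x. frechet_derivative g (at x) _"] 2 by auto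
qed

lemma Ck_on_subset: "Ck_on k S f \<Longrightarrow> T \<subseteq> S \<Longrightarrow> Ck_on k T f"
  by (induction k arbitrary: f) (auto intro: continuous_on_subset)

lemma Ck_on_Suc_imp: "Ck_on (Suc k) S f \<Longrightarrow> Ck_on k S f"
proof (induction k arbitrary: f)
  case 0
  then show ?case
    by (auto intro!: continuous_at_imp_continuous_on differentiable_imp_continuous_within)
next
  case (Suc k)
  from Suc.prems have "\<And>v. Ck_on (Suc k) S (\<lambda>x. frechet_derivative f (at x) v)" by simp
  with Suc show ?case by (metis Ck_on.simps(2))
qed

lemma Ck_on_mono: "Ck_on k S f \<Longrightarrow> j \<le> k \<Longrightarrow> Ck_on j S f"
  by (induction k) (auto simp: le_Suc_eq simp del: Ck_on.simps(2) dest: Ck_on_Suc_imp)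

lemma Ck_on_imp_continuous_on: "Ck_on k S f \<Longrightarrow> continuous_on S f"
  using Ck_on_mono[of k S f 0] by simp

text \<open>\<open>frechet_derivative\<close> is a choice operator; here an explicit derivative
  stands in for it. The closure properties below are inductions through this rule.\<close>

lemma Ck_on_SucI:
  assumes "open S" "\<And>x. x \<in> S \<Longrightarrow> (f has_derivative f' x) (at x)"
    and "\<And>v. Ck_on k S (\<lambda>x. f' x v)"
  shows "Ck_on (Suc k) S f"
proof -
  have "frechet_derivative f (at x) = f' x" if "x \<in> S" for x
    using assms(2)[OF that] frechet_derivative_at by metis
  then have "Ck_on k S (\<lambda>x. frechet_derivative f (at x) v)" for v
    using Ck_on_cong[OF \<open>open S\<close>, of "\<lambda>x. frechet_derivative f (at x) v" "\<lambda>x. f' x v" k] assms(3) by auto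
  with assms(2) show ?thesis by (auto simp: differentiable_def)
qed

lemma Ck_on_SucD:
  assumes "Ck_on (Suc k) S f"
  shows "x \<in> S \<Longrightarrow> (f has_derivative frechet_derivative f (at x)) (at x)"
    and "Ck_on k S (\<lambda>x. frechet_derivative f (at x) v)"
  using assms by (auto simp: frechet_derivative_works)

lemma Ck_on_const: "Ck_on k S (\<lambda>x. c)"
  by (induction k arbitrary: c) auto

lemma Ck_on_linear:
  assumes "open S" "bounded_linear L" "Ck_on k S f"
  shows "Ck_on k S (\<lambda>x. L (f x))"
  using assms(3)
proof (induction k arbitrary: f)
  case 0
  then show ?case by (auto intro: bounded_linear.continuous_on[OF assms(2)])
next
  case (Suc k)
  show ?case
    by (rule Ck_on_SucI[OF assms(1)])
      (auto intro!: bounded_linear.has_derivative[OF assms(2)] Ck_on_SucD(1)[OF Suc.prems]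
          Suc.IH Ck_on_SucD(2)[OF Suc.prems])
qed

lemma Ck_on_ident: "open S \<Longrightarrow> Ck_on k S (\<lambda>x. x)"
  by (cases k) (auto intro!: Ck_on_SucI derivative_eq_intros Ck_on_const simp del: Ck_on.simps(2) simp: Ck_on.simps(1))

lemma Ck_on_add:
  assumes "open S" "Ck_on k S f" "Ck_on k S g"
  shows "Ck_on k S (\<lambda>x. f x + g x)"
  using assms(2,3)
proof (induction k arbitrary: f g)
  case 0
  then show ?case by (auto intro: continuous_intros)
next
  case (Suc k)
  show ?case
    by (rule Ck_on_SucI[OF assms(1)], rule has_derivative_add)
      (rule Ck_on_SucD[OF Suc.prems(1)] Ck_on_SucD[OF Suc.prems(2)] Suc.IH | assumption)+
qed

lemma Ck_on_sum:
  assumes "open S" "\<And>i. i \<in> I \<Longrightarrow> Ck_on k S (f i)"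
  shows "Ck_on k S (\<lambda>x. \<Sum>i\<in>I. f i x)"
  using assms(2)
  by (induction I rule: infinite_finite_induct)
     (auto intro: Ck_on_const Ck_on_add[OF \<open>open S\<close>])

lemma (in bounded_bilinear) Ck_on:
  assumes "open S" "Ck_on k S f" "Ck_on k S g"
  shows "Ck_on k S (\<lambda>x. prod (f x) (g x))"
  using assms(2,3)
proof (induction k arbitrary: f g)
  case 0
  then show ?case by (auto intro: continuous_on)
next
  case (Suc k)
  show ?case
    by (rule Ck_on_SucI[OF assms(1)], rule FDERIV)
      (rule Ck_on_SucD[OF Suc.prems(1)] Ck_on_SucD[OF Suc.prems(2)] Ck_on_add[OF assms(1)] Suc.IH
        Ck_on_Suc_imp[OF Suc.prems(1)] Ck_on_Suc_imp[OF Suc.prems(2)] | assumption)+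
qed

lemmas Ck_on_mult = bounded_bilinear.Ck_on[OF bounded_bilinear_mult]
  and Ck_on_scaleR = bounded_bilinear.Ck_on[OF bounded_bilinear_scaleR]
  and Ck_on_inner = bounded_bilinear.Ck_on[OF bounded_bilinear_inner]

text \<open>The derivative of 1/f is a product of Df with factors 1/f, so the order of
  differentiability known for 1/f raises itself by one. The same bootstrap gives
  \<open>Ck_on_sqrt\<close>.\<close>

lemma Ck_on_inverse:
  fixes f :: "'a::real_normed_vector \<Rightarrow> real"
  assumes "open S" "Ck_on k S f" "\<And>x. x \<in> S \<Longrightarrow> f x \<noteq> 0"
  shows "Ck_on k S (\<lambda>x. inverse (f x))"
  using assms(2)
proof (induction k)
  case 0
  then show ?case using assms(3) by (auto intro: continuous_intros)
next
  case (Suc k)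
  have k: "Ck_on k S (\<lambda>x. inverse (f x))"
    using Suc Ck_on_Suc_imp by blast
  show ?case
  proof (rule Ck_on_SucI[OF assms(1)])
    show "((\<lambda>x. inverse (f x)) has_derivative
            (\<lambda>v. (-1) * ((inverse (f x) * frechet_derivative f (at x) v) * inverse (f x)))) (at x)"
      if "x \<in> S" for x
      using Deriv.has_derivative_inverse[OF assms(3)[OF that] Ck_on_SucD(1)[OF Suc.prems that]] by simp
  qed (intro Ck_on_mult assms k Ck_on_const Ck_on_SucD(2)[OF Suc.prems])
qed

lemma Ck_on_sqrt:
  assumes "open S" "Ck_on k S f" "\<And>x. x \<in> S \<Longrightarrow> f x > 0"
  shows "Ck_on k S (\<lambda>x. sqrt (f x))"
  using assms(2)
proof (induction k)
  case 0
  then show ?case by (auto intro: continuous_intros)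
next
  case (Suc k)
  have k: "Ck_on k S (\<lambda>x. sqrt (f x))"
    using Suc Ck_on_Suc_imp by blast
  show ?case
  proof (rule Ck_on_SucI[OF assms(1)])
    show "((\<lambda>x. sqrt (f x)) has_derivative
            (\<lambda>v. frechet_derivative f (at x) v * (inverse (sqrt (f x)) * (1/2)))) (at x)"
      if "x \<in> S" for x
      using has_derivative_real_sqrt[OF assms(3)[OF that] Ck_on_SucD(1)[OF Suc.prems that]]
      by (simp add: field_simps)
  qed (intro Ck_on_mult assms k Ck_on_const Ck_on_SucD(2)[OF Suc.prems] Ck_on_inverse,
       use assms(3) in force)
qed

section \<open>Chain rule and inverses of families of linear maps\<close>

lemma frechet_derivative_euclidean:
  fixes f :: "'a::euclidean_space \<Rightarrow> 'b::real_normed_vector"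
  assumes "f differentiable at x"
  shows "frechet_derivative f (at x) v = (\<Sum>b\<in>Basis. (v \<bullet> b) *\<^sub>R frechet_derivative f (at x) b)"
proof -
  interpret linear "frechet_derivative f (at x)"
    by (rule linear_frechet_derivative[OF assms])
  show ?thesis
    by (subst euclidean_representation[of v, symmetric]) (simp only: sum scale)
qed

text \<open>\<open>Ck_on\<close> controls derivatives in fixed directions, but the chain rule feeds
  the moving direction Dg(x)v into Df. Expanding it in the finite basis of the middle space leaves
  only fixed directions.\<close>

lemma Ck_on_compose:
  fixes f :: "'b::euclidean_space \<Rightarrow> 'c::real_normed_vector" and g :: "'a::real_normed_vector \<Rightarrow> 'b"
  assumes "open S" "g ` S \<subseteq> T" "Ck_on k T f" "Ck_on k S g"
  shows "Ck_on k S (\<lambda>x. f (g x))"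
  using assms(3,4)
proof (induction k arbitrary: f)
  case 0
  then show ?case using assms(2) by (auto intro: continuous_on_compose2)
next
  case (Suc k)
  show ?case
  proof (rule Ck_on_SucI[OF assms(1)])
    fix x assume x: "x \<in> S"
    have f: "(f has_derivative frechet_derivative f (at (g x))) (at (g x))"
      by (rule Ck_on_SucD(1)[OF Suc.prems(1)]) (use assms(2) x in auto)
    have "f differentiable at (g x)" using f by (auto simp: differentiable_def)
    then have eq: "(\<lambda>v. frechet_derivative f (at (g x)) (frechet_derivative g (at x) v))
        = (\<lambda>v. \<Sum>b\<in>Basis. (frechet_derivative g (at x) v \<bullet> b) *\<^sub>R frechet_derivative f (at (g x)) b)"
      by (intro ext frechet_derivative_euclidean)
    show "((\<lambda>x. f (g x)) has_derivative
        (\<lambda>v. \<Sum>b\<in>Basis. (frechet_derivative g (at x) v \<bullet> b) *\<^sub>R frechet_derivative f (at (g x)) b)) (at x)"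
      unfolding eq[symmetric]
      by (rule has_derivative_compose[OF Ck_on_SucD(1)[OF Suc.prems(2) x] f])
  next
    fix v
    show "Ck_on k S (\<lambda>x. \<Sum>b\<in>Basis. (frechet_derivative g (at x) v \<bullet> b) *\<^sub>R frechet_derivative f (at (g x)) b)"
      by (intro Ck_on_sum Ck_on_scaleR Ck_on_inner Ck_on_const assms(1) Ck_on_SucD(2)[OF Suc.prems(2)]
          Suc.IH Ck_on_SucD(2)[OF Suc.prems(1)] Ck_on_Suc_imp[OF Suc.prems(2)])
  qed
qed

lemma Ck_on_vecI:
  fixes f :: "'a::real_normed_vector \<Rightarrow> 'b::real_normed_vector ^ 'n"
  assumes "open S" "\<And>i. Ck_on k S (\<lambda>x. f x $ i)"
  shows "Ck_on k S f"
proof -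
  define L where "L i = (\<lambda>y::'b. (\<chi> j::'n. if j = i then y else 0))" for i
  have L: "bounded_linear (L i)" for i
  proof (rule bounded_linear_intro[where K=1])
    show "norm (L i x) \<le> norm x * 1" for x
    proof -
      have "norm (L i x) \<le> (\<Sum>j\<in>UNIV. norm (L i x $ j))"
        unfolding norm_vec_def by (rule L2_set_le_sum) auto
      also have "\<dots> = norm x" unfolding L_def by (simp add: if_distrib[of norm] sum.delta cong: if_cong)
      finally show ?thesis by simp
    qed
  qed (auto simp: L_def vec_eq_iff)
  have "f = (\<lambda>x. \<Sum>i\<in>UNIV. L i (f x $ i))"
    by (auto simp: fun_eq_iff vec_eq_iff L_def sum.delta')
  moreover have "Ck_on k S (\<lambda>x. \<Sum>i\<in>UNIV. L i (f x $ i))"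
    by (intro Ck_on_sum Ck_on_linear[OF assms(1) L] assms)
  ultimately show ?thesis by simp
qed

text \<open>Differentiability of \<open>B\<close> comes from the inverse function theorem for \<open>(x, p) \<mapsto> (x, A x p)\<close>.\<close>
lemma has_derivative_inverse_linear:
  fixes A B :: "'a::euclidean_space \<Rightarrow> 'b::euclidean_space \<Rightarrow> 'b"
  assumes "open S"
    and A: "\<And>x v. x \<in> S \<Longrightarrow> ((\<lambda>x. A x v) has_derivative A' x v) (at x)"
    and lin: "\<And>x. x \<in> S \<Longrightarrow> linear (A x)"
    and AB: "\<And>x v. x \<in> S \<Longrightarrow> A x (B x v) = v" and BA: "\<And>x v. x \<in> S \<Longrightarrow> B x (A x v) = v"
    and x: "x \<in> S"
  shows "((\<lambda>x. B x v) has_derivative (\<lambda>h. - B x (\<Sum>b\<in>Basis. (B x v \<bullet> b) *\<^sub>R A' x b h))) (at x)"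
proof -
  \<comment> \<open>\<open>A x p\<close> is expanded over the basis, because the hypotheses
    differentiate \<open>A x b\<close> in x only for fixed b.\<close>
  define F where "F = (\<lambda>(x, p). (x, \<Sum>b\<in>Basis. (p \<bullet> b) *\<^sub>R A x b))"
  define G where "G = (\<lambda>(x, q). (x, B x q))"
  define F' where "F' = (\<lambda>(x, p) (h, k). (h, (\<Sum>b\<in>Basis. (k \<bullet> b) *\<^sub>R A x b + (p \<bullet> b) *\<^sub>R A' x b h)))"
  \<comment> \<open>Obtained by solving F'(h, k) = (h, l) for k.\<close>
  define G' where "G' = (\<lambda>(x, p) (h, l). (h, B x (l - (\<Sum>b\<in>Basis. (p \<bullet> b) *\<^sub>R A' x b h))))"
  have sumA: "(\<Sum>b\<in>Basis. (p \<bullet> b) *\<^sub>R A x b) = A x p" if "x \<in> S" for x p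
  proof -
    interpret linear "A x" by (rule lin[OF that])
    show ?thesis by (subst (2) euclidean_representation[of p, symmetric]) (simp only: sum scale)
  qed
  have "(G has_derivative G' (x, B x v)) (at (F (x, B x v)))"
  proof (rule has_derivative_inverse_on[where S = "S \<times> UNIV" and f = F and f' = F' and g' = G' and x = "(x, B x v)"])
    show "open (S \<times> (UNIV :: 'b set))" using \<open>open S\<close> by (intro open_Times) auto
    show "(F has_derivative F' y) (at y)" if yS: "y \<in> S \<times> UNIV" for y
    proof -
      obtain a p where y: "y = (a, p)" "a \<in> S" using yS by auto
      have "((\<lambda>y. A (fst y) b) has_derivative (\<lambda>h. A' a b (fst h))) (at (a, p))" for b
        by (rule has_derivative_compose[where f = fst and g = "\<lambda>x. A x b"])
          (auto intro!: derivative_eq_intros A y)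
      then show ?thesis unfolding y F_def F'_def case_prod_beta fst_conv snd_conv
        by (auto intro!: derivative_eq_intros simp: add.commute)
    qed
    show "G (F y) = y" if "y \<in> S \<times> UNIV" for y
      using that unfolding F_def G_def by (auto simp: sumA BA)
    show "F' (x, B x v) \<circ> G' (x, B x v) = id"
      unfolding F'_def G'_def by (auto simp: fun_eq_iff sum.distrib sumA x AB)
    show "(x, B x v) \<in> S \<times> UNIV" using x by simp
  qed
  also have "F (x, B x v) = (x, v)" unfolding F_def by (simp add: sumA x AB)
  finally have G: "(G has_derivative G' (x, B x v)) (at (x, v))" .
  have "((\<lambda>y. snd (G (y, v))) has_derivative (\<lambda>h. snd (G' (x, B x v) (h, 0)))) (at x)"
    by (rule has_derivative_snd, rule has_derivative_compose[where f = "\<lambda>y. (y, v)" and g = G, OF _ G])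
      (auto intro!: derivative_eq_intros)
  moreover have "B x (- w) = - B x w" for w
  proof -
    have "A x (- B x w) = - w" by (simp add: linear_neg[OF lin] AB x)
    then show ?thesis using BA[OF x] by metis
  qed
  ultimately show ?thesis by (simp add: G_def G'_def)
qed

text \<open>The derivative of B = A^-1 is -B (DA) B. Over a basis, B occurs in it only in fixed
  directions, so each order known for B yields the next one as long as A supplies it.\<close>

lemma Ck_on_inverse_linear:
  fixes A B :: "'a::euclidean_space \<Rightarrow> 'b::euclidean_space \<Rightarrow> 'b"
  assumes "open S" and A: "\<And>v. Ck_on (Suc k) S (\<lambda>x. A x v)"
    and lin: "\<And>x. x \<in> S \<Longrightarrow> linear (A x)"
    and AB: "\<And>x v. x \<in> S \<Longrightarrow> A x (B x v) = v" and BA: "\<And>x v. x \<in> S \<Longrightarrow> B x (A x v) = v"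
  shows "Ck_on (Suc k) S (\<lambda>x. B x v)"
proof -
  define A' where "A' x v = frechet_derivative (\<lambda>x. A x v) (at x)" for x v
  have A': "((\<lambda>x. A x v) has_derivative A' x v) (at x)" if "x \<in> S" for x v
    unfolding A'_def by (rule Ck_on_SucD(1)[OF A that])
  have B': "((\<lambda>x. B x v) has_derivative (\<lambda>h. - B x (\<Sum>b\<in>Basis. (B x v \<bullet> b) *\<^sub>R A' x b h))) (at x)"
    if "x \<in> S" for x v
    by (rule has_derivative_inverse_linear[OF \<open>open S\<close> A' lin AB BA that])
  have linB: "linear (B x)" if "x \<in> S" for x
  proof (rule linearI)
    fix v w and r :: real
    have "A x (B x v + B x w) = v + w" "A x (r *\<^sub>R B x v) = r *\<^sub>R v"
      using that by (simp_all add: linear_add[OF lin] linear_scale[OF lin] AB)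
    then show "B x (v + w) = B x v + B x w" "B x (r *\<^sub>R v) = r *\<^sub>R B x v"
      using BA[OF that] by metis+
  qed
  have Bsum: "B x w = (\<Sum>c\<in>Basis. (w \<bullet> c) *\<^sub>R B x c)" if "x \<in> S" for x w
  proof -
    interpret linear "B x" by (rule linB[OF that])
    show ?thesis by (subst (1) euclidean_representation[of w, symmetric]) (simp only: sum scale)
  qed
  have B'': "((\<lambda>x. B x v) has_derivative (\<lambda>h. - (\<Sum>c\<in>Basis.
      ((\<Sum>b\<in>Basis. (B x v \<bullet> b) *\<^sub>R A' x b h) \<bullet> c) *\<^sub>R B x c))) (at x)" if "x \<in> S" for x v
    using B'[OF that, of v] unfolding Bsum[OF that, of "sum _ _"] .
  have neg: "Ck_on k S (\<lambda>x. - f x)" if "Ck_on k S f" for f :: "'a \<Rightarrow> 'b" and k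
    by (rule Ck_on_linear[OF \<open>open S\<close> _ that]) (rule bounded_linear_minus[OF bounded_linear_ident])
  have "j \<le> Suc k \<Longrightarrow> Ck_on j S (\<lambda>x. B x v)" for j
  proof (induction j arbitrary: v)
    case 0
    then show ?case
      by (auto intro!: continuous_at_imp_continuous_on has_derivative_continuous[OF B''])
  next
    case (Suc j)
    have A'j: "Ck_on j S (\<lambda>x. A' x b h)" for b h
      using Suc.prems Ck_on_mono[OF Ck_on_SucD(2)[OF A]] by (simp add: A'_def)
    show ?case
      by (rule Ck_on_SucI[OF \<open>open S\<close> B''], assumption)
       (use Suc in \<open>intro neg Ck_on_sum Ck_on_scaleR Ck_on_inner Ck_on_const \<open>open S\<close> A'j; simp\<close>)
  qed
  then show ?thesis by blast
qed

section \<open>Symmetry of second derivatives\<close>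

text \<open>The mean value theorem is applied twice: along u to the difference of f across t v, then
  along v to the derivative of f in direction u.\<close>

lemma second_difference_mvt:
  fixes f :: "'a::real_normed_vector \<Rightarrow> real"
  assumes "t > 0" and S: "\<And>a b. a \<in> {0..t} \<Longrightarrow> b \<in> {0..t} \<Longrightarrow> z + a *\<^sub>R u + b *\<^sub>R v \<in> S"
    and "Ck_on 2 S f"
  shows "\<exists>a b. 0 < a \<and> a < t \<and> 0 < b \<and> b < t \<and>
    f (z + t *\<^sub>R u + t *\<^sub>R v) - f (z + t *\<^sub>R u) - f (z + t *\<^sub>R v) + f z
      = t * (t * frechet_derivative (\<lambda>w. frechet_derivative f (at w) u) (at (z + a *\<^sub>R u + b *\<^sub>R v)) v)"
proof -
  define D where "D w = frechet_derivative f (at w) u" for w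
  have f: "Ck_on (Suc (Suc 0)) S f" using assms(3) by (simp add: numeral_2_eq_2)
  have D: "Ck_on (Suc 0) S D" unfolding D_def by (rule Ck_on_SucD(2)[OF f])
  define h where "h a = f (z + a *\<^sub>R u + t *\<^sub>R v) - f (z + a *\<^sub>R u + 0 *\<^sub>R v)" for a
  have h: "(h has_derivative (\<lambda>e. e * (D (z + a *\<^sub>R u + t *\<^sub>R v) - D (z + a *\<^sub>R u + 0 *\<^sub>R v)))) (at a)"
    if "a \<in> {0..t}" for a
  proof -
    have *: "((\<lambda>a. f (z + a *\<^sub>R u + b *\<^sub>R v)) has_derivative (\<lambda>e. e * D (z + a *\<^sub>R u + b *\<^sub>R v))) (at a)"
      if b: "b \<in> {0..t}" for b
    proof -
      have d: "(f has_derivative frechet_derivative f (at (z + a *\<^sub>R u + b *\<^sub>R v))) (at (z + a *\<^sub>R u + b *\<^sub>R v))"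
        by (rule Ck_on_SucD(1)[OF f S]) (use that b \<open>a \<in> _\<close> in auto)
      have "((\<lambda>a. z + a *\<^sub>R u + b *\<^sub>R v) has_derivative (\<lambda>e. e *\<^sub>R u)) (at a)"
        by (auto intro!: derivative_eq_intros)
      from has_derivative_compose[OF this d] show ?thesis
        unfolding D_def by (simp add: linear_simps[OF has_derivative_bounded_linear[OF d]])
    qed
    show ?thesis unfolding h_def right_diff_distrib
      by (intro has_derivative_diff *) (use \<open>t > 0\<close> in auto)
  qed
  obtain a where a: "0 < a" "a < t"
    "h t - h 0 = (t - 0) * (D (z + a *\<^sub>R u + t *\<^sub>R v) - D (z + a *\<^sub>R u + 0 *\<^sub>R v))"
    using mvt_simple[OF \<open>t > 0\<close>, of h] h has_derivative_at_withinI
    by (smt (verit) atLeastAtMost_iff greaterThanLessThan_iff)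
  define k where "k b = D (z + a *\<^sub>R u + b *\<^sub>R v)" for b
  have k: "(k has_derivative (\<lambda>e. e * frechet_derivative D (at (z + a *\<^sub>R u + b *\<^sub>R v)) v)) (at b)"
    if "b \<in> {0..t}" for b
  proof -
    have d: "(D has_derivative frechet_derivative D (at (z + a *\<^sub>R u + b *\<^sub>R v))) (at (z + a *\<^sub>R u + b *\<^sub>R v))"
      by (rule Ck_on_SucD(1)[OF D S]) (use that a in auto)
    have "((\<lambda>b. z + a *\<^sub>R u + b *\<^sub>R v) has_derivative (\<lambda>e. e *\<^sub>R v)) (at b)"
      by (auto intro!: derivative_eq_intros)
    from has_derivative_compose[OF this d] show ?thesis
      unfolding k_def by (simp add: linear_simps[OF has_derivative_bounded_linear[OF d]])
  qed
  obtain b where b: "0 < b" "b < t"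
    "k t - k 0 = (t - 0) * frechet_derivative D (at (z + a *\<^sub>R u + b *\<^sub>R v)) v"
    using mvt_simple[OF \<open>t > 0\<close>, of k] k has_derivative_at_withinI
    by (smt (verit) atLeastAtMost_iff greaterThanLessThan_iff)
  have "f (z + t *\<^sub>R u + t *\<^sub>R v) - f (z + t *\<^sub>R u) - f (z + t *\<^sub>R v) + f z = t * (k t - k 0)"
    using a(3) unfolding h_def k_def by simp
  then show ?thesis using a b unfolding D_def[symmetric] by auto
qed

text \<open>The second difference is symmetric in \<open>u\<close> and \<open>v\<close>.\<close>
lemma second_derivative_symmetric:
  fixes f :: "'a::real_normed_vector \<Rightarrow> real"
  assumes "open S" "z \<in> S" "Ck_on 2 S f"
  shows "frechet_derivative (\<lambda>w. frechet_derivative f (at w) u) (at z) v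
       = frechet_derivative (\<lambda>w. frechet_derivative f (at w) v) (at z) u"
proof -
  define H where "H u v y = frechet_derivative (\<lambda>w. frechet_derivative f (at w) u) (at y) v" for u v y
  have cont: "continuous_on S (H u v)" for u v
  proof -
    have "Ck_on (Suc (Suc 0)) S f" using assms(3) by (simp add: numeral_2_eq_2)
    from Ck_on_SucD(2)[OF Ck_on_SucD(2)[OF this]] show ?thesis unfolding H_def by simp
  qed
  obtain e where e: "e > 0" "ball z e \<subseteq> S" using assms openE by blast
  \<comment> \<open>This r keeps the parallelogram spanned by r u and r v inside the ball; the added
    1 keeps the denominator positive for u = v = 0.\<close>
  define r where "r = e / (2 * (norm u + norm v + 1))"
  define t where "t n = r / real (Suc n)" for n
  have r: "r > 0" unfolding r_def using e by (intro divide_pos_pos) (auto intro: add_nonneg_pos)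
  have t: "0 < t n" "t n \<le> r" for n using r by (auto simp: t_def field_simps)
  have small: "norm (a *\<^sub>R u + b *\<^sub>R v) < e" if "a \<in> {0..r}" "b \<in> {0..r}" for a b
  proof -
    have "norm (a *\<^sub>R u + b *\<^sub>R v) \<le> a * norm u + b * norm v"
      using that by (intro order_trans[OF norm_triangle_ineq]) auto
    also have "\<dots> \<le> r * norm u + r * norm v"
      using that by (intro add_mono mult_right_mono) auto
    also have "\<dots> \<le> r * (norm u + norm v + 1)" using r by (simp add: algebra_simps)
    also have "\<dots> = e / 2" unfolding r_def
      by (simp add: field_simps add_nonneg_eq_0_iff)
    finally show ?thesis using e by simp
  qed
  have inS: "z + a *\<^sub>R u + b *\<^sub>R v \<in> S" "z + b *\<^sub>R v + a *\<^sub>R u \<in> S"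
    if "a \<in> {0..r}" "b \<in> {0..r}" for a b
    using small[OF that] e(2) by (auto simp: subset_iff dist_norm norm_minus_commute algebra_simps)
  have box: "z + a *\<^sub>R u + b *\<^sub>R v \<in> S" "z + a *\<^sub>R v + b *\<^sub>R u \<in> S"
    if "a \<in> {0..t n}" "b \<in> {0..t n}" for a b n
    using inS[of a b] inS[of b a] that t(2)[of n] by auto
  have "\<exists>a b c d. a \<in> {0<..<t n} \<and> b \<in> {0<..<t n} \<and> c \<in> {0<..<t n} \<and> d \<in> {0<..<t n}
      \<and> H u v (z + a *\<^sub>R u + b *\<^sub>R v) = H v u (z + c *\<^sub>R v + d *\<^sub>R u)" for n
  proof -
    obtain a b where ab: "a \<in> {0<..<t n}" "b \<in> {0<..<t n}"
      "f (z + t n *\<^sub>R u + t n *\<^sub>R v) - f (z + t n *\<^sub>R u) - f (z + t n *\<^sub>R v) + f z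
        = t n * (t n * H u v (z + a *\<^sub>R u + b *\<^sub>R v))"
      using second_difference_mvt[OF t(1)[of n] _ assms(3), of z u v] box(1)[of _ n]
      unfolding H_def[symmetric] by force
    obtain c d where cd: "c \<in> {0<..<t n}" "d \<in> {0<..<t n}"
      "f (z + t n *\<^sub>R v + t n *\<^sub>R u) - f (z + t n *\<^sub>R v) - f (z + t n *\<^sub>R u) + f z
        = t n * (t n * H v u (z + c *\<^sub>R v + d *\<^sub>R u))"
      using second_difference_mvt[OF t(1)[of n] _ assms(3), of z v u] box(2)[of _ n]
      unfolding H_def[symmetric] by force
    \<comment> \<open>Both sides are the same second difference of f, so the mixed derivatives agree
      at two points that tend to z.\<close>
    have "t n * (t n * H u v (z + a *\<^sub>R u + b *\<^sub>R v)) = t n * (t n * H v u (z + c *\<^sub>R v + d *\<^sub>R u))"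
      unfolding ab(3)[symmetric] cd(3)[symmetric] by (simp add: algebra_simps)
    with ab cd t(1)[of n] show ?thesis by auto
  qed
  then obtain a b c d where abcd: "\<And>n. a n \<in> {0<..<t n}" "\<And>n. b n \<in> {0<..<t n}" "\<And>n. c n \<in> {0<..<t n}"
      "\<And>n. d n \<in> {0<..<t n}"
      and eq: "\<And>n. H u v (z + a n *\<^sub>R u + b n *\<^sub>R v) = H v u (z + c n *\<^sub>R v + d n *\<^sub>R u)"
    by metis
  have t0: "t \<longlonglongrightarrow> 0" unfolding t_def
    using LIMSEQ_Suc[OF lim_const_over_n[of r]] by simp
  have lim0: "s \<longlonglongrightarrow> 0" if "\<And>n. s n \<in> {0<..<t n}" for s
    by (rule tendsto_sandwich[OF _ _ tendsto_const t0]) (use that in \<open>auto intro!: always_eventually less_imp_le\<close>)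
  have "(\<lambda>n. H u v (z + a n *\<^sub>R u + b n *\<^sub>R v)) \<longlonglongrightarrow> H u v (z + 0 *\<^sub>R u + 0 *\<^sub>R v)"
    using cont[of u v] assms(1,2)
    by (intro isCont_tendsto_compose[of _ "H u v"] tendsto_intros lim0 abcd) (auto simp: continuous_on_eq_continuous_at)
  moreover have "(\<lambda>n. H v u (z + c n *\<^sub>R v + d n *\<^sub>R u)) \<longlonglongrightarrow> H v u (z + 0 *\<^sub>R v + 0 *\<^sub>R u)"
    using cont[of v u] assms(1,2)
    by (intro isCont_tendsto_compose[of _ "H v u"] tendsto_intros lim0 abcd) (auto simp: continuous_on_eq_continuous_at)
  ultimately have "H u v z = H v u z"
    using LIMSEQ_unique unfolding eq by fastforce
  then show ?thesis unfolding H_def .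
qed

section \<open>Proper local diffeomorphisms and hyperplane complements\<close>

text \<open>Local injectivity follows from continuity of Df in operator norm. \<open>Ck_on\<close>
  gives continuity direction by direction, and the sum over the finite basis bounds the operator
  norm.\<close>

lemma Ck1_locally_injective:
  fixes f :: "'a::euclidean_space \<Rightarrow> 'b::euclidean_space"
  assumes f: "Ck_on (Suc 0) S f" and "open S" "a \<in> S" and inj: "inj (frechet_derivative f (at a))"
  obtains r where "r > 0" "ball a r \<subseteq> S" "inj_on f (ball a r)"
proof -
  let ?D = "\<lambda>x. frechet_derivative f (at x)"
  have D: "(f has_derivative ?D x) (at x)" if "x \<in> S" for x
    by (rule Ck_on_SucD(1)[OF f that])
  have cont: "isCont (\<lambda>x. ?D x v) a" for v
    using Ck_on_SucD(2)[OF f, of v] assms(2,3) by (simp add: continuous_on_eq_continuous_at)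
  obtain g' where g': "linear g'" "g' \<circ> ?D a = id"
    using linear_injective_left_inverse[OF has_derivative_linear[OF D[OF assms(3)]] inj] by blast
  show ?thesis
  proof (rule has_derivative_locally_injective[OF assms(3,2) _ g'(2) D])
    show "bounded_linear g'" using g'(1) by (simp add: linear_conv_bounded_linear)
    show "\<exists>d>0. \<forall>x. dist a x < d \<longrightarrow> onorm (\<lambda>v. ?D x v - ?D a v) < e" if "e > 0" for e :: real
    proof -
      have "((\<lambda>x. \<Sum>b\<in>Basis. norm (?D x b - ?D a b)) \<longlongrightarrow> (\<Sum>b\<in>Basis. norm (?D a b - ?D a b))) (at a)"
        using cont by (intro tendsto_intros) (simp add: isCont_def)
      then have "\<forall>\<^sub>F x in at a. (\<Sum>b\<in>Basis. norm (?D x b - ?D a b)) < e"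
        by (rule order_tendstoD) (use \<open>e > 0\<close> in simp)
      then obtain d1 where d1: "d1 > 0" "\<And>x. x \<noteq> a \<Longrightarrow> dist x a < d1 \<Longrightarrow> (\<Sum>b\<in>Basis. norm (?D x b - ?D a b)) < e"
        unfolding eventually_at by blast
      obtain d2 where d2: "d2 > 0" "ball a d2 \<subseteq> S" using assms(2,3) openE by blast
      have "onorm (\<lambda>v. ?D x v - ?D a v) < e" if "dist a x < min d1 d2" for x
      proof -
        have x: "x \<in> S" "dist x a < d1" using that d2 by (auto simp: dist_commute)
        have "onorm (\<lambda>v. ?D x v - ?D a v) \<le> (\<Sum>b\<in>Basis. norm (?D x b - ?D a b))"
          by (intro onorm_componentwise bounded_linear_sub has_derivative_bounded_linear[OF D] x assms)
        moreover have "(\<Sum>b\<in>Basis. norm (?D x b - ?D a b)) < e"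
          using d1(2)[OF _ x(2)] \<open>e > 0\<close> by (cases "x = a") simp_all
        ultimately show ?thesis by simp
      qed
      then show ?thesis using d1 d2 by (intro exI[of _ "min d1 d2"]) auto
    qed
  qed (assumption, rule that)
qed

text \<open>Local injectivity and invariance of domain.\<close>

lemma Ck1_open_map:
  fixes f :: "'a::euclidean_space \<Rightarrow> 'a"
  assumes f: "Ck_on (Suc 0) S f" and "open S" and inj: "\<And>x. x \<in> S \<Longrightarrow> inj (frechet_derivative f (at x))"
  shows "open (f ` S)"
proof (subst open_subopen, safe)
  fix x assume x: "x \<in> S"
  obtain r where r: "r > 0" "ball x r \<subseteq> S" "inj_on f (ball x r)"
    using Ck1_locally_injective[OF f \<open>open S\<close> x inj[OF x]] by blast
  have "continuous_on (ball x r) f"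
    using Ck_on_imp_continuous_on[OF f] r(2) continuous_on_subset by blast
  then have "open (f ` ball x r)"
    using r(3) invariance_of_domain by blast
  then show "\<exists>T. open T \<and> f x \<in> T \<and> T \<subseteq> f ` S"
    using r by (intro exI[of _ "f ` ball x r"]) auto
qed

text \<open>The set of points with two distinct preimages is open and closed, and it misses \<open>f z0\<close>.\<close>
lemma proper_local_diffeo_bij:
  fixes f :: "'a::euclidean_space \<Rightarrow> 'a"
  assumes f: "Ck_on (Suc 0) M f" and M: "open M"
    and inj: "\<And>x. x \<in> M \<Longrightarrow> inj (frechet_derivative f (at x))"
    and proper: "\<And>K. compact K \<Longrightarrow> compact {x \<in> M. f x \<in> K}"
    and z0: "z0 \<in> M" "\<And>z. z \<in> M \<Longrightarrow> f z = f z0 \<Longrightarrow> z = z0"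
  shows "bij_betw f M UNIV"
proof -
  have cont: "continuous_on M f" by (rule Ck_on_imp_continuous_on[OF f])
  have op: "open (f ` U)" if "open U" "U \<subseteq> M" for U
    by (rule Ck1_open_map[OF Ck_on_subset[OF f that(2)] that(1) inj]) (use that in auto)
  \<comment> \<open>Properness in sequential form: the values together with their limit w form a
    compact set, whose preimage is compact.\<close>
  have limit: "\<exists>x\<in>M. \<exists>r. strict_mono r \<and> (s \<circ> r) \<longlonglongrightarrow> x \<and> f x = w"
    if s: "\<And>n. s n \<in> M" and w: "(\<lambda>n. f (s n)) \<longlonglongrightarrow> w" for s :: "nat \<Rightarrow> 'a" and w
  proof -
    let ?K = "insert w (range (\<lambda>n. f (s n)))"
    have "compact {x \<in> M. f x \<in> ?K}" by (intro proper compact_sequence_with_limit w)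
    moreover have "\<forall>n. s n \<in> {x \<in> M. f x \<in> ?K}" using s by auto
    ultimately obtain x r where x: "x \<in> M" "strict_mono (r :: nat \<Rightarrow> nat)" "(s \<circ> r) \<longlonglongrightarrow> x"
      unfolding compact_def by blast
    have "(\<lambda>n. f ((s \<circ> r) n)) \<longlonglongrightarrow> f x"
      using cont x M s by (intro isCont_tendsto_compose[of x f]) (auto simp: continuous_on_eq_continuous_at o_def)
    moreover have "(\<lambda>n. f ((s \<circ> r) n)) \<longlonglongrightarrow> w"
      using LIMSEQ_subseq_LIMSEQ[OF w x(2)] by (simp add: o_def)
    ultimately show ?thesis using x LIMSEQ_unique by blast
  qed
  define A where "A = {w. \<exists>x\<in>M. \<exists>y\<in>M. x \<noteq> y \<and> f x = w \<and> f y = w}"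
  have "open A"
  proof (subst open_subopen, safe)
    fix w assume "w \<in> A"
    then obtain x y where xy: "x \<in> M" "y \<in> M" "x \<noteq> y" "f x = w" "f y = w" by (auto simp: A_def)
    obtain U V where UV: "open U" "open V" "x \<in> U" "y \<in> V" "U \<inter> V = {}"
      using hausdorff[OF xy(3)] by blast
    \<comment> \<open>Disjoint neighbourhoods of x and y have open images, and every common value
      has two distinct preimages.\<close>
    have "open (f ` (U \<inter> M) \<inter> f ` (V \<inter> M))" using UV M by (intro open_Int op) auto
    moreover have "w \<in> f ` (U \<inter> M)" using UV(3) xy(1) xy(4)[symmetric] by (intro image_eqI IntI)
    moreover have "w \<in> f ` (V \<inter> M)" using UV(4) xy(2) xy(5)[symmetric] by (intro image_eqI IntI)
    moreover have "f ` (U \<inter> M) \<inter> f ` (V \<inter> M) \<subseteq> A"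
    proof
      fix w' assume "w' \<in> f ` (U \<inter> M) \<inter> f ` (V \<inter> M)"
      then obtain p q where pq: "p \<in> U \<inter> M" "w' = f p" "q \<in> V \<inter> M" "w' = f q"
        unfolding Int_iff image_iff Bex_def by iprover
      then have "p \<noteq> q" using UV(5) by blast
      then show "w' \<in> A" unfolding A_def using pq by auto
    qed
    ultimately show "\<exists>T. open T \<and> w \<in> T \<and> T \<subseteq> A"
      by (intro exI[of _ "f ` (U \<inter> M) \<inter> f ` (V \<inter> M)"] conjI IntI)
  qed
  moreover have "closed A"
    unfolding closed_sequential_limits
  proof safe
    fix s w assume s: "\<forall>n. s n \<in> A" and w: "s \<longlonglongrightarrow> w"
    from s obtain x y where xy: "\<And>n. x n \<in> M" "\<And>n. y n \<in> M" "\<And>n. x n \<noteq> y n" "\<And>n. f (x n) = s n" "\<And>n. f (y n) = s n"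
      unfolding A_def by (simp add: Bex_def) metis
    obtain x0 r where x0: "x0 \<in> M" "strict_mono r" "(x \<circ> r) \<longlonglongrightarrow> x0" "f x0 = w"
      using limit[of x w] xy w by auto
    have "(\<lambda>n. f ((y \<circ> r) n)) \<longlonglongrightarrow> w" using LIMSEQ_subseq_LIMSEQ[OF w x0(2)] by (simp add: o_def xy)
    then obtain y0 q where y0: "y0 \<in> M" "strict_mono q" "(y \<circ> r \<circ> q) \<longlonglongrightarrow> y0" "f y0 = w"
      using limit[of "y \<circ> r" w] xy by auto
    have x0': "(x \<circ> r \<circ> q) \<longlonglongrightarrow> x0" by (rule LIMSEQ_subseq_LIMSEQ[OF x0(3) y0(2)])
    \<comment> \<open>The two preimages cannot merge in the limit, because f is injective near
      x0.\<close>
    have "x0 \<noteq> y0"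
    proof
      assume eq: "x0 = y0"
      obtain d where d: "d > 0" "ball x0 d \<subseteq> M" "inj_on f (ball x0 d)"
        using Ck1_locally_injective[OF f M x0(1) inj[OF x0(1)]] by blast
      have "\<forall>\<^sub>F n in sequentially. (x \<circ> r \<circ> q) n \<in> ball x0 d \<and> (y \<circ> r \<circ> q) n \<in> ball x0 d"
        by (intro eventually_conj topological_tendstoD[OF x0'] topological_tendstoD[OF y0(3)])
          (use d eq in auto)
      then obtain n where n: "x (r (q n)) \<in> ball x0 d" "y (r (q n)) \<in> ball x0 d"
        unfolding eventually_sequentially by auto
      then have "x (r (q n)) = y (r (q n))" using inj_onD[OF d(3)] xy by metis
      with xy(3) show False by blast
    qed
    with x0 y0 show "w \<in> A" unfolding A_def by blast
  qed
  ultimately have "A = {} \<or> A = UNIV" using clopen by blast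
  moreover have "f z0 \<notin> A" unfolding A_def using z0 by auto
  ultimately have "A = {}" by blast
  then have "inj_on f M" unfolding A_def inj_on_def by blast
  \<comment> \<open>Surjectivity: the image is closed by properness, open, and nonempty.\<close>
  moreover have "closed (f ` M)"
    unfolding closed_sequential_limits
  proof safe
    fix s w assume s: "\<forall>n. s n \<in> f ` M" and w: "s \<longlonglongrightarrow> w"
    from s obtain x where x: "\<And>n. x n \<in> M" "\<And>n. f (x n) = s n" unfolding image_iff by metis
    show "w \<in> f ` M" using limit[of x w] x w by auto
  qed
  moreover have "open (f ` M)" "f ` M \<noteq> {}" using op[OF M] z0(1) by auto
  ultimately show ?thesis using clopen[of "f ` M"] by (simp add: bij_betw_def)
qed

text \<open>The derivative of the inverse g at w is the inverse of Df at g w. That family of linear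
  maps is smooth in its base point, so composing with g gains one order for g at each induction
  step.\<close>

lemma smooth_bij_inverse:
  fixes f :: "'a::euclidean_space \<Rightarrow> 'a"
  assumes f: "smooth_on M f" and M: "open M"
    and inj: "\<And>x. x \<in> M \<Longrightarrow> inj (frechet_derivative f (at x))"
    and bij: "bij_betw f M UNIV"
  shows "smooth_on UNIV (inv_into M f)"
proof -
  let ?D = "\<lambda>x. frechet_derivative f (at x)"
  define g where "g = inv_into M f"
  define B where "B x = inv (?D x)" for x
  have g: "g w \<in> M" "f (g w) = w" "\<And>x. x \<in> M \<Longrightarrow> g (f x) = x" for w
    using bij unfolding g_def bij_betw_def by (auto simp: inv_into_into f_inv_into_f)
  have Ck: "Ck_on k M f" for k using f by (simp add: smooth_on_def)
  have D: "(f has_derivative ?D x) (at x)" if "x \<in> M" for x by (rule Ck_on_SucD(1)[OF Ck that])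
  have bijD: "bij (?D x)" if "x \<in> M" for x
    using linear_injective_imp_surjective[OF has_derivative_linear[OF D[OF that]] inj[OF that]] inj[OF that]
    by (simp add: bij_def)
  have BD: "B x (?D x v) = v" "?D x (B x v) = v" if "x \<in> M" for x v
    unfolding B_def using bijD[OF that]
    by (auto simp: bij_is_inj bij_is_surj inv_f_f surj_f_inv_f)
  have CkB: "Ck_on k M (\<lambda>x. B x v)" for k v
    by (rule Ck_on_Suc_imp, rule Ck_on_inverse_linear[OF M Ck_on_SucD(2)[OF Ck] has_derivative_linear[OF D]])
      (use BD in auto)
  have g': "(g has_derivative B (g w)) (at w)" for w
    using has_derivative_inverse_on[of M f ?D g "g w" B] M D g BD(2)[OF g(1)] by (auto simp: fun_eq_iff)
  have "Ck_on k UNIV g" for k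
  proof (induction k)
    case 0
    then show ?case by (auto intro!: continuous_at_imp_continuous_on has_derivative_continuous[OF g'])
  next
    case (Suc k)
    show ?case
      by (rule Ck_on_SucI[OF open_UNIV g'], rule Ck_on_compose[OF open_UNIV _ CkB Suc]) (use g in auto)
  qed
  then show ?thesis unfolding smooth_on_def g_def by blast
qed

section \<open>Connectedness of complements of coordinate hyperplanes\<close>

lemma connected_component_Diff_hyperplane:
  fixes a b :: "complex^'n"
  assumes "convex T" "a \<in> T" "b \<in> T" "\<And>t. 0 \<le> t \<Longrightarrow> t \<le> 1 \<Longrightarrow> (1 - t) *\<^sub>R a $ j + t *\<^sub>R b $ j \<noteq> 0"
  shows "connected_component (T - {z. z $ j = 0}) a b"
proof -
  have "closed_segment a b \<subseteq> T" using assms(1-3) by (simp add: closed_segment_subset)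
  moreover have "closed_segment a b \<inter> {z. z $ j = 0} = {}"
    using assms(4) by (auto simp: closed_segment_def)
  ultimately have "closed_segment a b \<subseteq> T - {z. z $ j = 0}" by blast
  then show ?thesis
    using connected_component_of_subset connected_segment connected_component_def
    by (metis ends_in_segment)
qed

lemma norm_axis: "norm (axis j x :: 'a::real_normed_vector ^ 'n) = norm x"
proof -
  have "(norm (axis j x :: 'a ^ 'n))\<^sup>2 = (\<Sum>i\<in>UNIV. if i = j then (norm x)\<^sup>2 else 0)"
    unfolding norm_vec_def L2_set_def axis_def
    by (simp add: sum_nonneg if_distrib[of norm] if_distrib[of "\<lambda>y. y\<^sup>2"] cong: if_cong)
  also have "\<dots> = (norm x)\<^sup>2" by (simp add: sum.delta)
  finally show ?thesis by (simp add: power2_eq_iff_nonneg)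
qed

text \<open>Two points \<open>a\<close>, \<open>b\<close> of a ball off the hyperplane are joined by the two segments
  through \<open>a + \<epsilon> i a\<^sub>j e\<^sub>j\<close>, unless the segment between them already avoids it.\<close>
lemma connected_component_ball_Diff_hyperplane:
  fixes a b :: "complex^'n"
  assumes "a \<in> ball c r" "b \<in> ball c r" "a $ j \<noteq> 0" "b $ j \<noteq> 0"
  shows "connected_component (ball c r - {z. z $ j = 0}) a b"
proof (cases "b $ j / a $ j \<in> \<real> \<and> Re (b $ j / a $ j) < 0")
  case False
  show ?thesis
  proof (rule connected_component_Diff_hyperplane[OF convex_ball assms(1,2)])
    fix t :: real assume t: "0 \<le> t" "t \<le> 1"
    define q where "q = b $ j / a $ j"
    have q: "b $ j = q * a $ j" "q \<noteq> 0" "Im q = 0 \<longrightarrow> Re q \<ge> 0"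
      using assms(3,4) False by (auto simp: q_def complex_is_Real_iff)
    \<comment> \<open>Dividing by \<open>a $ j\<close> turns the j-th coordinate into the segment
      from 1 to q, which for nonzero q meets 0 only if q is real and negative.\<close>
    have "(1 - t) *\<^sub>R 1 + t *\<^sub>R q \<noteq> 0"
    proof
      assume "(1 - t) *\<^sub>R 1 + t *\<^sub>R q = 0"
      then have "1 - t + t * Re q = 0" "t * Im q = 0" by (auto simp: complex_eq_iff)
      with q t show False
        by (cases "t = 0") (auto simp: complex_eq_iff add_nonneg_eq_0_iff)
    qed
    then have "((1 - t) *\<^sub>R 1 + t *\<^sub>R q) * a $ j \<noteq> 0" using assms(3) by simp
    then show "(1 - t) *\<^sub>R a $ j + t *\<^sub>R b $ j \<noteq> 0" by (simp add: q(1) algebra_simps)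
  qed
next
  case True
  define l where "l = Re (b $ j / a $ j)"
  have "b $ j / a $ j = of_real l" using True by (simp add: l_def complex_is_Real_iff complex_eq_iff)
  then have l: "b $ j = l *\<^sub>R a $ j" "l < 0"
    using True assms(3) by (simp_all add: l_def field_simps scaleR_conv_of_real)
  obtain d where d: "d > 0" "ball a d \<subseteq> ball c r" using assms(1) openE[OF open_ball] by blast
  \<comment> \<open>With this e the detour point m lies at distance d / 2 from a.\<close>
  define e where "e = d / (2 * cmod (a $ j))"
  have e: "e > 0" using d(1) assms(3) by (simp add: e_def)
  define m where "m = a + axis j (\<i> * e *\<^sub>R a $ j)"
  have mj: "m $ j = (1 + \<i> * e) * a $ j"
    by (simp add: m_def axis_def algebra_simps scaleR_conv_of_real)
  have "dist a m = e * cmod (a $ j)" using e by (simp add: m_def dist_norm norm_mult norm_axis)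
  also have "\<dots> < d" using d(1) assms(3) by (simp add: e_def)
  finally have m: "m \<in> ball c r" using d(2) by auto
  have ne: "(x + \<i> * y) * a $ j \<noteq> 0" if "x \<noteq> 0 \<or> y \<noteq> 0" for x y :: real
  proof -
    have "complex_of_real x + \<i> * y \<noteq> 0" using that by (auto simp: complex_eq_iff)
    with assms(3) show ?thesis by simp
  qed
  have "connected_component (ball c r - {z. z $ j = 0}) a m"
  proof (rule connected_component_Diff_hyperplane[OF convex_ball assms(1) m])
    fix t :: real
    have "(1 - t) *\<^sub>R a $ j + t *\<^sub>R m $ j = ((1::real) + \<i> * (t * e)) * a $ j"
      by (simp add: mj algebra_simps scaleR_conv_of_real)
    then show "(1 - t) *\<^sub>R a $ j + t *\<^sub>R m $ j \<noteq> 0" using ne[of 1 "t * e"] by simp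
  qed
  moreover have "connected_component (ball c r - {z. z $ j = 0}) m b"
  proof (rule connected_component_Diff_hyperplane[OF convex_ball m assms(2)])
    fix t :: real
    have "(1 - t) *\<^sub>R m $ j + t *\<^sub>R b $ j = ((1 - t + t * l :: real) + \<i> * ((1 - t) * e :: real)) * a $ j"
      by (simp add: mj l algebra_simps scaleR_conv_of_real)
    \<comment> \<open>The imaginary factor (1 - t) e vanishes only at t = 1, where the real factor
      is l < 0.\<close>
    then show "(1 - t) *\<^sub>R m $ j + t *\<^sub>R b $ j \<noteq> 0"
      using ne[of "1 - t + t * l" "(1 - t) * e"] e l by (cases "t = 1") simp_all
  qed
  ultimately show ?thesis using connected_component_trans by blast
qed

lemma coordinate_hyperplane_nowhere_dense:
  fixes T :: "(complex^'n) set"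
  assumes "open T" "a \<in> T"
  shows "\<exists>z\<in>T. z $ j \<noteq> 0"
proof (cases "a $ j = 0")
  case True
  obtain d where d: "d > 0" "ball a d \<subseteq> T" using assms openE by blast
  have "a + axis j (of_real (d / 2)) \<in> ball a d"
    using d(1) by (simp add: dist_norm norm_axis del: of_real_divide)
  moreover have "(a + axis j (of_real (d / 2))) $ j \<noteq> 0"
    using d(1) True by (simp add: axis_def)
  ultimately show ?thesis using d(2) by blast
qed (use assms in auto)

text \<open>Inside small balls any two points off the hyperplane are connected, and the hyperplane
  contains no nonempty open set, so this local relation spreads over the connected set M.\<close>

lemma connected_Diff_coordinate_hyperplane:
  fixes M :: "(complex^'n) set"
  assumes M: "open M" "connected M"
  shows "connected (M - {z. z $ j = 0})"
  unfolding connected_iff_connected_component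
proof (intro ballI)
  fix a b assume "a \<in> M - {z. z $ j = 0}" "b \<in> M - {z. z $ j = 0}"
  then have ab: "a \<in> M" "b \<in> M" "a $ j \<noteq> 0" "b $ j \<noteq> 0" by auto
  show "connected_component (M - {z. z $ j = 0}) a b"
  proof (rule connected_equivalence_relation_gen[OF M(2) ab connected_component_trans])
    show "\<exists>z. z \<in> T \<and> z $ j \<noteq> 0" if "openin (top_of_set M) T" "x \<in> T" for T x
    proof -
      have "open T" using that(1) by (simp add: openin_open_eq[OF M(1)])
      from coordinate_hyperplane_nowhere_dense[OF this that(2)] show ?thesis unfolding Bex_def .
    qed
    show "\<exists>T. openin (top_of_set M) T \<and> x \<in> T \<and>
      (\<forall>y\<in>T. \<forall>z\<in>T. y $ j \<noteq> 0 \<and> z $ j \<noteq> 0 \<longrightarrow> connected_component (M - {z. z $ j = 0}) y z)"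
      if x: "x \<in> M" for x
    proof -
      obtain d where d: "d > 0" "ball x d \<subseteq> M" using M(1) x openE by blast
      have "connected_component (M - {z. z $ j = 0}) y z"
        if "y \<in> ball x d" "z \<in> ball x d" "y $ j \<noteq> 0" "z $ j \<noteq> 0" for y z
        by (rule connected_component_of_subset[OF connected_component_ball_Diff_hyperplane[OF that]])
          (use d(2) in auto)
      then show ?thesis using d
        by (intro exI[of _ "ball x d"]) (simp add: openin_open_eq[OF M(1)])
    qed
  qed
qed

section \<open>Rotation invariant potentials\<close>

lemma inner_ii [simp]:
  "(\<i> * x) \<bullet> x = 0" "x \<bullet> (\<i> * x) = 0" "(\<i> * x) \<bullet> (\<i> * y) = x \<bullet> y"
  by (simp_all add: inner_complex_def)

lemma inner_ii_left: "(\<i> * x) \<bullet> y = - (x \<bullet> (\<i> * y))"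
  by (simp add: inner_complex_def)

lemma Jmul_nth [simp]: "Jmul u $ k = \<i> * u $ k"
  by (simp add: Jmul_def)

lemma bounded_linear_axis: "bounded_linear (axis k :: 'a::real_normed_vector \<Rightarrow> 'a ^ 'n)"
  by (rule bounded_linear_intro[where K = 1]) (auto simp: axis_def vec_eq_iff norm_axis[unfolded axis_def])

text \<open>For a potential \<open>F(|z\<^sub>1|\<^sup>2, \<dots>, |z\<^sub>n|\<^sup>2)\<close> the function \<open>f k\<close> is \<open>\<partial>F/\<partial>x\<^sub>k\<close>, evaluated at
  \<open>(|z\<^sub>1|\<^sup>2, \<dots>, |z\<^sub>n|\<^sup>2)\<close>.\<close>
definition toric_potential ::
  "(complex^'n) set \<Rightarrow> (complex^'n \<Rightarrow> real) \<Rightarrow> ('n \<Rightarrow> complex^'n \<Rightarrow> real) \<Rightarrow> bool" where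
  "toric_potential S P f \<longleftrightarrow> open S \<and>
     (\<forall>z\<in>S. (P has_derivative (\<lambda>u. \<Sum>k\<in>UNIV. 2 * f k z * (z $ k \<bullet> u $ k))) (at z) \<and>
            (\<forall>k. f k differentiable at z) \<and>
            (\<forall>u v. hess P z u v = hess P z v u))"

lemma toric_hess:
  assumes P: "toric_potential S P f" and z: "z \<in> S"
  shows "hess P z u v = (\<Sum>k\<in>UNIV. 2 * (frechet_derivative (f k) (at z) v * (z $ k \<bullet> u $ k) + f k z * (v $ k \<bullet> u $ k)))"
proof -
  let ?Q = "\<lambda>w. \<Sum>k\<in>UNIV. 2 * f k w * (w $ k \<bullet> u $ k)"
  have f: "(f k has_derivative frechet_derivative (f k) (at z)) (at z)" for k
    using P z by (auto simp: toric_potential_def frechet_derivative_works)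
  have Q: "(?Q has_derivative (\<lambda>v. \<Sum>k\<in>UNIV. 2 * f k z * (v $ k \<bullet> u $ k) + 2 * frechet_derivative (f k) (at z) v * (z $ k \<bullet> u $ k))) (at z)"
    by (auto intro!: derivative_eq_intros f bounded_linear.has_derivative[OF bounded_linear_vec_nth])
  have "?Q w = frechet_derivative P (at w) u" if "w \<in> S" for w
  proof -
    have "(P has_derivative (\<lambda>u. \<Sum>k\<in>UNIV. 2 * f k w * (w $ k \<bullet> u $ k))) (at w)"
      using P that by (simp add: toric_potential_def)
    from fun_cong[OF frechet_derivative_at[OF this], of u] show ?thesis .
  qed
  then have "((\<lambda>w. frechet_derivative P (at w) u) has_derivative (\<lambda>v. \<Sum>k\<in>UNIV. 2 * f k z * (v $ k \<bullet> u $ k) + 2 * frechet_derivative (f k) (at z) v * (z $ k \<bullet> u $ k))) (at z)"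
    using has_derivative_transform_within_open[OF Q, of S] z P by (simp add: toric_potential_def)
  from frechet_derivative_at[OF this, symmetric] show ?thesis
    unfolding hess_def by (simp add: algebra_simps)
qed

text \<open>Symmetry of the Hessian, with the visibly symmetric part sum f_k <v_k, u_k>
  cancelled.\<close>

lemma toric_sym:
  assumes P: "toric_potential S P f" and z: "z \<in> S"
  shows "(\<Sum>k\<in>UNIV. frechet_derivative (f k) (at z) v * (z $ k \<bullet> u $ k)) =
    (\<Sum>k\<in>UNIV. frechet_derivative (f k) (at z) u * (z $ k \<bullet> v $ k))"
proof -
  have "hess P z u v = hess P z v u" using P z by (simp add: toric_potential_def)
  then show ?thesis
    unfolding toric_hess[OF P z] sum_distrib_left[symmetric] sum.distrib by (simp add: inner_commute)
qed

text \<open>The right side is the exterior derivative of (1/2) sum f_k <i z_k, dz_k>, which is (1/2)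
  sum f_k |z_k|^2 dtheta_k in polar coordinates. Symmetry of the Hessian removes \<open>Jmul\<close>
  from the arguments of the Df_k.\<close>

lemma toric_kform:
  assumes P: "toric_potential S P f" and z: "z \<in> S"
  shows "kform P z u v = (\<Sum>k\<in>UNIV. f k z * ((\<i> * u $ k) \<bullet> v $ k) +
    (((\<i> * z $ k) \<bullet> v $ k) * frechet_derivative (f k) (at z) u
     - ((\<i> * z $ k) \<bullet> u $ k) * frechet_derivative (f k) (at z) v) / 2)"
proof -
  let ?D = "\<lambda>k. frechet_derivative (f k) (at z)"
  have "(\<Sum>k\<in>UNIV. ?D k (Jmul v) * (z $ k \<bullet> u $ k)) = (\<Sum>k\<in>UNIV. ?D k u * (z $ k \<bullet> (\<i> * v $ k)))"
    using toric_sym[OF P z, of "Jmul v" u] by simp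
  also have "\<dots> = (\<Sum>k\<in>UNIV. - ((\<i> * z $ k) \<bullet> v $ k) * ?D k u)"
    by (intro sum.cong) (simp_all add: inner_ii_left)
  finally have *: "(\<Sum>k\<in>UNIV. ?D k (Jmul v) * (z $ k \<bullet> u $ k)) = (\<Sum>k\<in>UNIV. - ((\<i> * z $ k) \<bullet> v $ k) * ?D k u)" .
  have "hess P z u (Jmul v) = 2 * (\<Sum>k\<in>UNIV. ?D k (Jmul v) * (z $ k \<bullet> u $ k)) + (\<Sum>k\<in>UNIV. 2 * f k z * ((\<i> * v $ k) \<bullet> u $ k))"
    unfolding toric_hess[OF P z] by (simp add: sum.distrib sum_distrib_left algebra_simps)
  also have "\<dots> = (\<Sum>k\<in>UNIV. 2 * (- ((\<i> * z $ k) \<bullet> v $ k) * ?D k u) + 2 * f k z * ((\<i> * v $ k) \<bullet> u $ k))"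
    unfolding * by (simp only: sum.distrib sum_distrib_left)
  finally have 2: "hess P z u (Jmul v) = \<dots>" .
  have "kform P z u v = ((\<Sum>k\<in>UNIV. 2 * (?D k v * (z $ k \<bullet> Jmul u $ k) + f k z * (v $ k \<bullet> Jmul u $ k))) -
      (\<Sum>k\<in>UNIV. 2 * (- ((\<i> * z $ k) \<bullet> v $ k) * ?D k u) + 2 * f k z * ((\<i> * v $ k) \<bullet> u $ k))) / 4"
    unfolding kform_def 2 unfolding toric_hess[OF P z] ..
  also have "\<dots> = (\<Sum>k\<in>UNIV. (2 * (?D k v * (z $ k \<bullet> Jmul u $ k) + f k z * (v $ k \<bullet> Jmul u $ k)) -
      (2 * (- ((\<i> * z $ k) \<bullet> v $ k) * ?D k u) + 2 * f k z * ((\<i> * v $ k) \<bullet> u $ k))) / 4)"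
    unfolding sum_divide_distrib[symmetric] sum_subtractf ..
  also have "\<dots> = (\<Sum>k\<in>UNIV. f k z * ((\<i> * u $ k) \<bullet> v $ k) +
      (((\<i> * z $ k) \<bullet> v $ k) * ?D k u - ((\<i> * z $ k) \<bullet> u $ k) * ?D k v) / 2)"
  proof (intro sum.cong refl)
    fix k
    have "v $ k \<bullet> Jmul u $ k = (\<i> * u $ k) \<bullet> v $ k" "z $ k \<bullet> Jmul u $ k = - ((\<i> * z $ k) \<bullet> u $ k)"
      "(\<i> * v $ k) \<bullet> u $ k = - ((\<i> * u $ k) \<bullet> v $ k)"
      by (simp_all add: inner_complex_def)
    then show "(2 * (?D k v * (z $ k \<bullet> Jmul u $ k) + f k z * (v $ k \<bullet> Jmul u $ k)) -
        (2 * (- ((\<i> * z $ k) \<bullet> v $ k) * ?D k u) + 2 * f k z * ((\<i> * v $ k) \<bullet> u $ k))) / 4 =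
        f k z * ((\<i> * u $ k) \<bullet> v $ k) +
        (((\<i> * z $ k) \<bullet> v $ k) * ?D k u - ((\<i> * z $ k) \<bullet> u $ k) * ?D k v) / 2"
      by (simp only:) (simp add: field_simps)
  qed
  finally show ?thesis .
qed

text \<open>The function \<open>f\<^sub>k |z\<^sub>k|\<^sup>2\<close> is, up to a factor, the Hamiltonian of the rotation of the \<open>k\<close>-th coordinate.\<close>
lemma toric_moment:
  assumes P: "toric_potential S P f" and z: "z \<in> S"
  shows "((\<lambda>z. f k z * (cmod (z $ k))\<^sup>2) has_derivative (\<lambda>v. - 2 * kform P z (axis k (\<i> * z $ k)) v)) (at z)"
proof -
  let ?D = "\<lambda>k. frechet_derivative (f k) (at z)"
  let ?X = "axis k (\<i> * z $ k)"
  have f: "(f k has_derivative ?D k) (at z)"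
    using P z by (auto simp: toric_potential_def frechet_derivative_works)
  have "((\<lambda>z. f k z * (z $ k \<bullet> z $ k)) has_derivative
      (\<lambda>v. f k z * (2 * (z $ k \<bullet> v $ k)) + ?D k v * (z $ k \<bullet> z $ k))) (at z)"
    by (auto intro!: derivative_eq_intros f bounded_linear.has_derivative[OF bounded_linear_vec_nth]
        simp: inner_commute)
  moreover have "- 2 * kform P z ?X v = f k z * (2 * (z $ k \<bullet> v $ k)) + ?D k v * (z $ k \<bullet> z $ k)" for v
  proof -
    \<comment> \<open>The f_j do not change along the rotation in the sense of this sum:
      \<open>toric_sym\<close> trades the derivative along \<open>?X\<close> for the pairing of z
      with \<open>?X\<close>, and i z_k is orthogonal to z_k.\<close>
    have "(\<Sum>j\<in>UNIV. ((\<i> * z $ j) \<bullet> v $ j) * ?D j ?X) = - (\<Sum>j\<in>UNIV. ?D j ?X * (z $ j \<bullet> Jmul v $ j))"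
      unfolding sum_negf[symmetric] by (intro sum.cong) (simp_all add: inner_ii_left)
    also have "\<dots> = - (\<Sum>j\<in>UNIV. ?D j (Jmul v) * (z $ j \<bullet> ?X $ j))"
      using toric_sym[OF P z, of ?X "Jmul v"] by simp
    also have "(\<Sum>j\<in>UNIV. ?D j (Jmul v) * (z $ j \<bullet> ?X $ j)) = 0"
      by (intro sum.neutral) (simp add: axis_def)
    finally have 1: "(\<Sum>j\<in>UNIV. ((\<i> * z $ j) \<bullet> v $ j) * ?D j ?X) = 0" by simp
    have 2: "(\<Sum>j\<in>UNIV. f j z * ((\<i> * ?X $ j) \<bullet> v $ j)) = - (f k z * (z $ k \<bullet> v $ k))"
      by (subst sum.remove[of _ k]) (auto intro!: sum.neutral simp: axis_def)
    have 3: "(\<Sum>j\<in>UNIV. ((\<i> * z $ j) \<bullet> ?X $ j) * ?D j v) = (z $ k \<bullet> z $ k) * ?D k v"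
      by (subst sum.remove[of _ k]) (auto intro!: sum.neutral simp: axis_def)
    show ?thesis
      unfolding toric_kform[OF P z] sum.distrib sum_subtractf sum_divide_distrib[symmetric] 1 2 3
      by (simp add: algebra_simps)
  qed
  ultimately show ?thesis by (simp add: power2_norm_eq_inner)
qed

text \<open>Every term with a factor z_k drops out, and the form on e_k and i e_k is just
  f_k.\<close>

lemma toric_pos_if_nth_eq_0:
  assumes P: "toric_potential S P f" and z: "z \<in> S" "z $ k = 0"
    and pos: "kform P z (axis k 1) (Jmul (axis k 1)) > 0"
  shows "f k z > 0"
proof -
  have "kform P z (axis k 1) (Jmul (axis k 1)) = f k z"
    unfolding toric_kform[OF P z(1)]
    by (subst sum.remove[of _ k]) (auto intro!: sum.neutral simp: axis_def z)
  with pos show ?thesis by simp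
qed

text \<open>A zero of \<open>f k \<ge> 0\<close> is a minimum, where the radial derivative of \<open>f\<^sub>k |z\<^sub>k|\<^sup>2\<close> vanishes; this contradicts positivity
  of the form.\<close>
lemma toric_pos_if_nonneg:
  assumes P: "toric_potential S P f" and z: "z \<in> S"
    and pos: "\<And>u. u \<noteq> 0 \<Longrightarrow> kform P z u (Jmul u) > 0"
    and nonneg: "\<And>z. z \<in> S \<Longrightarrow> f k z \<ge> 0"
  shows "f k z > 0"
proof (cases "z $ k = 0")
  case True
  then show ?thesis using toric_pos_if_nth_eq_0[OF P z] pos[of "axis k 1"] by (simp add: axis_eq_0_iff)
next
  case False
  let ?X = "axis k (\<i> * z $ k)"
  show ?thesis
  proof (rule ccontr)
    assume "\<not> f k z > 0"
    then have f0: "f k z = 0" using nonneg[OF z] by simp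
    have "open S" using P by (simp add: toric_potential_def)
    have "f k z * (cmod (z $ k))\<^sup>2 \<le> f k y * (cmod (y $ k))\<^sup>2" if "y \<in> S" for y
      using nonneg[OF that] f0 by simp
    then have "(\<lambda>v. - 2 * kform P z ?X v) = (\<lambda>v. 0)"
      using differential_zero_maxmin[OF z \<open>open S\<close> toric_moment[OF P z, of k]] by blast
    \<comment> \<open>\<open>Jmul ?X\<close> is the radial vector with k-th entry -z_k.\<close>
    from fun_cong[OF this, of "Jmul ?X"] have "kform P z ?X (Jmul ?X) = 0" by simp
    moreover have "?X \<noteq> 0" using False by (simp add: axis_eq_0_iff)
    ultimately show False using pos[of ?X] by simp
  qed
qed

section \<open>Special maps: rotation equivariance and symplecticity\<close>

text \<open>A special map commutes with rotations of one coordinate, since these preserve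
  \<open>sqmod\<close>; differentiate at angle 0.\<close>

lemma special_derivative_rotation:
  assumes M: "open M" "z \<in> M" and d: "(Psi has_derivative D) (at z)"
    and sp: "\<And>z. z \<in> M \<Longrightarrow> Psi z = (\<chi> j. complex_of_real (psi j (sqmod z)) * z $ j)"
  shows "D (axis k (\<i> * z $ k)) = axis k (\<i> * Psi z $ k)"
proof -
  \<comment> \<open>\<open>c w t\<close> rotates the k-th coordinate of w by the angle t.\<close>
  define c where "c w t = w + axis k ((cis t - 1) * w $ k)" for w :: "complex^'a" and t
  have c': "(c w has_derivative (\<lambda>t. t *\<^sub>R axis k (\<i> * w $ k))) (at 0)" for w
  proof -
    have "((\<lambda>t. (of_real (cos t) + \<i> * of_real (sin t) - 1) * w $ k) has_derivative (\<lambda>t. t *\<^sub>R (\<i> * w $ k))) (at 0)"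
      by (auto intro!: derivative_eq_intros simp: scaleR_conv_of_real)
    from bounded_linear.has_derivative[OF bounded_linear_axis this]
    have "((\<lambda>t. w + axis k ((of_real (cos t) + \<i> * of_real (sin t) - 1) * w $ k)) has_derivative
        (\<lambda>t. axis k (t *\<^sub>R (\<i> * w $ k)))) (at 0)"
      by (auto intro!: derivative_eq_intros)
    moreover have "axis k (t *\<^sub>R (\<i> * w $ k)) = t *\<^sub>R axis k (\<i> * w $ k)" for t
      by (simp add: axis_def vec_eq_iff)
    ultimately show ?thesis unfolding c_def cis_conv_exp by (simp add: exp_Euler cos_of_real sin_of_real)
  qed
  have c0: "c w 0 = w" for w by (simp add: c_def vec_eq_iff axis_def)
  have cnth: "c w t $ j = (if j = k then cis t * w $ j else w $ j)" for w t j
    by (simp add: c_def axis_def algebra_simps)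
  have sq: "sqmod (c w t) = sqmod w" for w t by (simp add: sqmod_def vec_eq_iff cnth norm_mult)
  have "((\<lambda>t. Psi (c z t)) has_derivative (\<lambda>t. D (t *\<^sub>R axis k (\<i> * z $ k)))) (at 0)"
    by (rule has_derivative_compose[OF c']) (simp add: c0 d)
  moreover have "((\<lambda>t. Psi (c z t)) has_derivative (\<lambda>t. t *\<^sub>R axis k (\<i> * Psi z $ k))) (at 0)"
  proof (rule has_derivative_transform_eventually[OF c'])
    have "isCont (c z) 0" by (rule has_derivative_continuous[OF c'])
    then have "\<forall>\<^sub>F t in at 0. c z t \<in> M"
      using M by (intro topological_tendstoD[of "c z" z]) (auto simp: isCont_def c0)
    then show "\<forall>\<^sub>F t in at 0. c (Psi z) t = Psi (c z t)"
      by (rule eventually_mono) (auto simp: sp M(2) sq cnth vec_eq_iff)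
  qed (simp_all add: c0)
  ultimately have "(\<lambda>t. D (t *\<^sub>R axis k (\<i> * z $ k))) = (\<lambda>t. t *\<^sub>R axis k (\<i> * Psi z $ k))"
    by (rule has_derivative_unique)
  from fun_cong[OF this, of 1] show ?thesis by simp
qed

text \<open>Psi preserves the forms and carries rotation field to rotation field, so the two
  Hamiltonians differ by a constant. It is 0 at z0, where \<open>Psi z0 $ k\<close> is a multiple of
  \<open>z0 $ k\<close>.\<close>

lemma special_symplectic_moment:
  assumes P: "toric_potential M P f" and G: "toric_potential S G g" and "connected M"
    and z0: "z0 \<in> M" "z0 $ k = 0"
    and Psi: "ssi M P S G Psi" and z: "z \<in> M"
  shows "g k (Psi z) * (cmod (Psi z $ k))\<^sup>2 = f k z * (cmod (z $ k))\<^sup>2"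
proof -
  have M: "open M" using P by (simp add: toric_potential_def)
  obtain psi where sp: "\<And>z. z \<in> M \<Longrightarrow> Psi z = (\<chi> j. complex_of_real (psi j (sqmod z)) * z $ j)"
    using Psi unfolding ssi_def special_map_def by blast
  have S: "Psi z \<in> S" if "z \<in> M" for z using Psi that unfolding ssi_def by blast
  have Ck: "Ck_on (Suc 0) M Psi" using Psi unfolding ssi_def special_map_def smooth_on_def by blast
  define h where "h z = g k (Psi z) * (cmod (Psi z $ k))\<^sup>2 - f k z * (cmod (z $ k))\<^sup>2" for z
  have "(h has_derivative (\<lambda>v. 0)) (at z)" if z: "z \<in> M" for z
  proof -
    let ?D = "frechet_derivative Psi (at z)"
    let ?X = "axis k (\<i> * z $ k)"
    have D: "(Psi has_derivative ?D) (at z)" by (rule Ck_on_SucD(1)[OF Ck z])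
    have "(h has_derivative (\<lambda>v. - 2 * kform G (Psi z) (axis k (\<i> * Psi z $ k)) (?D v) - (- 2 * kform P z ?X v))) (at z)"
      unfolding h_def
      by (intro has_derivative_diff toric_moment[OF P z] has_derivative_compose[OF D toric_moment[OF G S[OF z]]])
    moreover have "kform G (Psi z) (axis k (\<i> * Psi z $ k)) (?D v) = kform P z ?X v" for v
      using Psi z special_derivative_rotation[OF M z D sp, of k, symmetric]
      unfolding ssi_def symplectic_on_def by auto
    ultimately show ?thesis by simp
  qed
  then have "h z = h z0"
    using has_derivative_zero_unique_connected[OF M \<open>connected M\<close>] z z0 by blast
  also have "h z0 = 0" unfolding h_def using z0 sp[OF z0(1)] by simp
  finally show ?thesis unfolding h_def by simp
qed

text \<open>Real factors give <i Psi_k, dPsi_k> = psi_k^2 <i z_k, dz_k>, so the equation for f_k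
  says that Psi pulls back g_k <i w_k, dw_k> to f_k <i z_k, dz_k>. The forms then agree summand by
  summand.\<close>

lemma special_symplecticI:
  assumes P: "toric_potential M P f" and G: "toric_potential S G g"
    and Psi: "\<And>z. z \<in> M \<Longrightarrow> Psi z = (\<chi> k. complex_of_real (psi k z) * z $ k)"
    and S: "\<And>z. z \<in> M \<Longrightarrow> Psi z \<in> S"
    and diff: "\<And>z k. z \<in> M \<Longrightarrow> psi k differentiable at z"
    and D: "\<And>z. z \<in> M \<Longrightarrow> Psi differentiable at z"
    and eq: "\<And>z k. z \<in> M \<Longrightarrow> f k z = g k (Psi z) * (psi k z)\<^sup>2"
  shows "symplectic_on M P G Psi"
  unfolding symplectic_on_def
proof (intro ballI allI)
  fix z u v assume z: "z \<in> M"
  have M: "open M" using P by (simp add: toric_potential_def)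
  let ?D = "frechet_derivative Psi (at z)"
  let ?p = "\<lambda>k. frechet_derivative (psi k) (at z)"
  let ?f = "\<lambda>k. frechet_derivative (f k) (at z)"
  let ?g = "\<lambda>k. frechet_derivative (g k) (at (Psi z))"
  have p: "(psi k has_derivative ?p k) (at z)" for k using diff[OF z] by (simp add: frechet_derivative_works)
  have D: "(Psi has_derivative ?D) (at z)" using D[OF z] by (simp add: frechet_derivative_works)
  have g: "(g k has_derivative ?g k) (at (Psi z))" for k
    using G S[OF z] by (simp add: toric_potential_def frechet_derivative_works)
  have D': "?D u $ k = psi k z *\<^sub>R u $ k + ?p k u *\<^sub>R z $ k" for u k
  proof -
    have 1: "((\<lambda>z. psi k z *\<^sub>R z $ k) has_derivative (\<lambda>u. psi k z *\<^sub>R u $ k + ?p k u *\<^sub>R z $ k)) (at z)"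
      by (intro has_derivative_scaleR p bounded_linear.has_derivative[OF bounded_linear_vec_nth] has_derivative_ident)
    have "((\<lambda>z. Psi z $ k) has_derivative (\<lambda>u. psi k z *\<^sub>R u $ k + ?p k u *\<^sub>R z $ k)) (at z)"
      by (rule has_derivative_transform_within_open[OF 1 M z]) (simp add: Psi scaleR_conv_of_real)
    from fun_cong[OF has_derivative_unique[OF bounded_linear.has_derivative[OF bounded_linear_vec_nth D] this], of u]
    show ?thesis .
  qed
  have f': "?f k u = ?g k (?D u) * (psi k z)\<^sup>2 + g k (Psi z) * (2 * psi k z * ?p k u)" for u k
  proof -
    have 1: "((\<lambda>z. g k (Psi z) * (psi k z)\<^sup>2) has_derivative
        (\<lambda>u. ?g k (?D u) * (psi k z)\<^sup>2 + g k (Psi z) * (2 * psi k z * ?p k u))) (at z)"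
      by (auto intro!: derivative_eq_intros has_derivative_compose[OF D g] p)
    have "(f k has_derivative (\<lambda>u. ?g k (?D u) * (psi k z)\<^sup>2 + g k (Psi z) * (2 * psi k z * ?p k u))) (at z)"
      by (rule has_derivative_transform_within_open[OF 1 M z]) (simp add: eq)
    from fun_cong[OF frechet_derivative_at[OF this], of u] show ?thesis by (rule sym)
  qed
  show "kform G (Psi z) (?D u) (?D v) = kform P z u v"
    unfolding toric_kform[OF P z] toric_kform[OF G S[OF z]]
  proof (intro sum.cong refl)
    fix k
    have Pk: "Psi z $ k = psi k z *\<^sub>R z $ k" using Psi[OF z] by (simp add: scaleR_conv_of_real)
    have W: "(\<i> * ?D u $ k) \<bullet> ?D v $ k = (psi k z)\<^sup>2 * ((\<i> * u $ k) \<bullet> v $ k)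
        + psi k z * ?p k u * ((\<i> * z $ k) \<bullet> v $ k) - psi k z * ?p k v * ((\<i> * z $ k) \<bullet> u $ k)"
      unfolding D' by (simp add: inner_complex_def power2_eq_square algebra_simps)
    have B: "(\<i> * Psi z $ k) \<bullet> ?D u $ k = (psi k z)\<^sup>2 * ((\<i> * z $ k) \<bullet> u $ k)" for u
      unfolding D' Pk by (simp add: inner_complex_def power2_eq_square algebra_simps)
    show "g k (Psi z) * ((\<i> * ?D u $ k) \<bullet> ?D v $ k) +
        (((\<i> * Psi z $ k) \<bullet> ?D v $ k) * ?g k (?D u) - ((\<i> * Psi z $ k) \<bullet> ?D u $ k) * ?g k (?D v)) / 2 =
        f k z * ((\<i> * u $ k) \<bullet> v $ k) +
        (((\<i> * z $ k) \<bullet> v $ k) * ?f k u - ((\<i> * z $ k) \<bullet> u $ k) * ?f k v) / 2"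
      unfolding f' eq[OF z] W B by (simp add: field_simps)
  qed
qed

section \<open>Special symplectic immersions into the model spaces\<close>

text \<open>The flat, hyperbolic and Fubini--Study potentials are the cases \<open>c = 0, -1, 1\<close>.\<close>
definition model_pot :: "real \<Rightarrow> complex^'n \<Rightarrow> real" where
  "model_pot c z = (if c = 0 then (norm z)\<^sup>2 else ln (1 + c * (norm z)\<^sup>2) / c)"

definition model_dom :: "real \<Rightarrow> (complex^'n) set" where
  "model_dom c = {z. 1 + c * (norm z)\<^sup>2 > 0}"

lemma model_pot_simps:
  "flat_pot = model_pot 0" "hyp_pot = model_pot (- 1)" "FS_pot = model_pot 1"
  by (auto simp: fun_eq_iff model_pot_def flat_pot_def hyp_pot_def FS_pot_def)

lemma model_dom_simps:
  "model_dom 0 = UNIV" "model_dom (- 1) = ball 0 1" "model_dom 1 = UNIV"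
  by (auto simp: model_dom_def abs_square_less_1 add_pos_nonneg)

text \<open>The differential is 2 <w, u> / N with N = 1 + c |w|^2, so the single function 1/N serves
  for every k.\<close>

lemma toric_model_pot:
  "toric_potential (model_dom c) (model_pot c) (\<lambda>k w. 1 / (1 + c * (norm (w :: complex^'n))\<^sup>2))"
  unfolding toric_potential_def
proof (intro conjI ballI allI)
  have "open {z :: complex^'n. 0 < 1 + c * (norm z)\<^sup>2}"
    by (intro open_Collect_less continuous_intros)
  then show op: "open (model_dom c :: (complex^'n) set)" by (simp add: model_dom_def)
  let ?N = "\<lambda>z :: complex^'n. 1 + c * (z \<bullet> z)"
  have N: "1 + c * (norm z)\<^sup>2 = ?N z" for z by (simp add: power2_norm_eq_inner)
  fix w :: "complex^'n" assume "w \<in> model_dom c"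
  then have w: "?N w > 0" by (simp add: model_dom_def N)
  have d: "(model_pot c has_derivative (\<lambda>u. (2 * (z \<bullet> u)) / ?N z)) (at z)" if "z \<in> model_dom c" for z
  proof (cases "c = 0")
    case True
    have "((\<lambda>z :: complex^'n. z \<bullet> z) has_derivative (\<lambda>u. 2 * (z \<bullet> u))) (at z)"
      by (auto intro!: derivative_eq_intros simp: inner_commute)
    with True show ?thesis by (simp add: model_pot_def[abs_def] power2_norm_eq_inner)
  next
    case False
    have z: "?N z > 0" using that by (simp add: model_dom_def N)
    have "((\<lambda>z. ln (?N z)) has_derivative (\<lambda>u. c * (2 * (z \<bullet> u)) / ?N z)) (at z)"
      using z by (auto intro!: derivative_eq_intros simp: inner_commute divide_inverse)
    from bounded_linear.has_derivative[OF bounded_linear_divide this, of c] False show ?thesis by (simp add: model_pot_def[abs_def] power2_norm_eq_inner)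
  qed
  show "(model_pot c has_derivative (\<lambda>u. \<Sum>k\<in>UNIV. 2 * (1 / (1 + c * (norm w)\<^sup>2)) * (w $ k \<bullet> u $ k))) (at w)"
    using d[OF \<open>w \<in> model_dom c\<close>] by (simp add: N inner_vec_def sum_distrib_left sum_divide_distrib)
  show "(\<lambda>w. 1 / (1 + c * (norm w)\<^sup>2)) differentiable at w"
    unfolding N using w by (auto intro!: derivative_intros)
  have hess: "hess (model_pot c) w u v = 2 * (v \<bullet> u) / ?N w - 4 * c * (w \<bullet> u) * (w \<bullet> v) / (?N w)\<^sup>2" for u v
  proof -
    have "((\<lambda>z. (2 * (z \<bullet> u)) / ?N z) has_derivative
        (\<lambda>v. ((2 * (v \<bullet> u)) * ?N w - (2 * (w \<bullet> u)) * (c * (2 * (w \<bullet> v)))) / (?N w * ?N w))) (at w)"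
      using w by (intro has_derivative_divide') (auto intro!: derivative_eq_intros simp: inner_commute)
    moreover have "((2 * (v \<bullet> u)) * N - (2 * (w \<bullet> u)) * (c * (2 * (w \<bullet> v)))) / (N * N) =
        2 * (v \<bullet> u) / N - 4 * c * (w \<bullet> u) * (w \<bullet> v) / N\<^sup>2" if "N > 0" for v and N :: real
      using that by (simp add: diff_divide_distrib power2_eq_square)
    ultimately have 1: "((\<lambda>z. (2 * (z \<bullet> u)) / ?N z) has_derivative
        (\<lambda>v. 2 * (v \<bullet> u) / ?N w - 4 * c * (w \<bullet> u) * (w \<bullet> v) / (?N w)\<^sup>2)) (at w)"
      using w by simp
    have "((\<lambda>z. frechet_derivative (model_pot c) (at z) u) has_derivative
        (\<lambda>v. 2 * (v \<bullet> u) / ?N w - 4 * c * (w \<bullet> u) * (w \<bullet> v) / (?N w)\<^sup>2)) (at w)"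
      by (rule has_derivative_transform_within_open[OF 1 op \<open>w \<in> model_dom c\<close>])
        (rule fun_cong[OF frechet_derivative_at[OF d]])
    from fun_cong[OF frechet_derivative_at[OF this], of v] show ?thesis unfolding hess_def by (rule sym)
  qed
  show "hess (model_pot c) w u v = hess (model_pot c) w v u" for u v
    unfolding hess by (simp add: inner_commute mult_ac)
qed

section \<open>Squared moduli, and properness as growth at the boundary\<close>

lemma Ck_on_vec_nth:
  fixes f :: "'a::real_normed_vector \<Rightarrow> 'b::real_normed_vector ^ 'n"
  shows "open S \<Longrightarrow> Ck_on k S f \<Longrightarrow> Ck_on k S (\<lambda>x. f x $ i)"
  by (rule Ck_on_linear[OF _ bounded_linear_vec_nth])

lemma Ck_on_sqmod: "open S \<Longrightarrow> Ck_on k S sqmod"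
  by (rule Ck_on_vecI)
    (simp_all add: sqmod_def power2_norm_eq_inner Ck_on_inner Ck_on_vec_nth Ck_on_ident)

lemma has_derivative_sqmod:
  "(sqmod has_derivative (\<lambda>u. \<Sum>k\<in>UNIV. axis k (2 * (z $ k \<bullet> u $ k)))) (at (z :: complex^'n))"
proof -
  have "((\<lambda>z. \<Sum>k\<in>UNIV. axis k (z $ k \<bullet> z $ k)) has_derivative (\<lambda>u. \<Sum>k\<in>UNIV. axis k (2 * (z $ k \<bullet> u $ k)))) (at z)"
    by (rule has_derivative_sum, rule bounded_linear.has_derivative[OF bounded_linear_axis])
      (auto intro!: derivative_eq_intros bounded_linear.has_derivative[OF bounded_linear_vec_nth] simp: inner_commute)
  moreover have "sqmod = (\<lambda>z :: complex^'n. \<Sum>k\<in>UNIV. axis k (z $ k \<bullet> z $ k))"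
    by (auto simp: fun_eq_iff sqmod_def vec_eq_iff axis_def power2_norm_eq_inner sum.delta' if_distrib cong: if_cong)
  ultimately show ?thesis by simp
qed

text \<open>Growth at infinity bounds the preimage of a compact set, and growth at the frontier
  keeps its limit points in M. Conversely, |Psi| exceeds R off the compact preimage of the ball of
  radius R.\<close>

lemma lim_bdry_infty_iff_proper:
  fixes Psi :: "complex^'n \<Rightarrow> complex^'n"
  assumes M: "open M" and cont: "continuous_on M Psi"
  shows "lim_bdry_infty M (\<lambda>z. (norm (Psi z))\<^sup>2) \<longleftrightarrow> (\<forall>K. compact K \<longrightarrow> compact {z \<in> M. Psi z \<in> K})"
proof (intro iffI allI impI)
  fix K :: "(complex^'n) set"
  assume lim: "lim_bdry_infty M (\<lambda>z. (norm (Psi z))\<^sup>2)" and K: "compact K"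
  obtain R where R: "\<And>w. w \<in> K \<Longrightarrow> norm w < R" "R > 0"
    using compact_imp_bounded[OF K] unfolding bounded_pos_less by blast
  have notK: "Psi z \<notin> K" if "R\<^sup>2 \<le> (norm (Psi z))\<^sup>2" for z
    using that R(1)[of "Psi z"] R(2) power_mono_iff[of R "norm (Psi z)" 2] by auto
  let ?C = "{z \<in> M. Psi z \<in> K}"
  have "\<forall>\<^sub>F z in at_infinity. z \<in> M \<longrightarrow> R\<^sup>2 \<le> (norm (Psi z))\<^sup>2"
    using lim unfolding lim_bdry_infty_def filterlim_at_top eventually_inf_principal by blast
  then obtain b where b: "\<And>z. b \<le> norm z \<Longrightarrow> z \<in> M \<Longrightarrow> R\<^sup>2 \<le> (norm (Psi z))\<^sup>2"
    unfolding eventually_at_infinity by blast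
  have "bounded ?C"
    unfolding bounded_iff by (intro exI[of _ b] ballI) (use b notK in force)
  moreover have "closed ?C"
    unfolding closed_sequential_limits
  proof (intro allI impI)
    fix s z assume "(\<forall>n. s n \<in> ?C) \<and> s \<longlonglongrightarrow> z"
    then have s: "\<And>n. s n \<in> M" "\<And>n. Psi (s n) \<in> K" "s \<longlonglongrightarrow> z" by auto
    have "z \<in> M"
    proof (rule ccontr)
      assume z: "z \<notin> M"
      have "z \<in> closure M" using s closure_sequential by blast
      then have "z \<in> frontier M" using z M by (simp add: frontier_def interior_open)
      then have "\<forall>\<^sub>F y in at z within M. R\<^sup>2 \<le> (norm (Psi y))\<^sup>2"
        using lim unfolding lim_bdry_infty_def filterlim_at_top by blast
      moreover have "filterlim s (at z within M) sequentially"
        unfolding filterlim_at using s z by (auto intro!: always_eventually)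
      ultimately have "\<forall>\<^sub>F n in sequentially. R\<^sup>2 \<le> (norm (Psi (s n)))\<^sup>2"
        by (rule eventually_compose_filterlim)
      then show False using notK s(2) by (auto simp: eventually_sequentially)
    qed
    then have "isCont Psi z" using cont M by (simp add: continuous_on_eq_continuous_at)
    then have "(\<lambda>n. Psi (s n)) \<longlonglongrightarrow> Psi z" using s(3) by (rule isCont_tendsto_compose)
    then have "Psi z \<in> K"
      using closed_sequentially[OF compact_imp_closed[OF K], of "\<lambda>n. Psi (s n)"] s(2) by simp
    with \<open>z \<in> M\<close> show "z \<in> ?C" by simp
  qed
  ultimately show "compact ?C" by (simp add: compact_eq_bounded_closed)
next
  assume proper: "\<forall>K. compact K \<longrightarrow> compact {z \<in> M. Psi z \<in> K}"
  have *: "(\<forall>\<^sub>F z in inf at_infinity (principal M). Z \<le> (norm (Psi z))\<^sup>2) \<and>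
        (\<forall>z0\<in>frontier M. \<forall>\<^sub>F z in at z0 within M. Z \<le> (norm (Psi z))\<^sup>2)" for Z :: real
  proof -
    \<comment> \<open>\<open>max Z 0\<close> keeps R nonnegative with R^2 at least Z, for negative Z
      too.\<close>
    define R where "R = sqrt (max Z 0)"
    let ?C = "{z \<in> M. Psi z \<in> cball 0 R}"
    have C: "compact ?C" using proper compact_cball by blast
    have Z: "Z \<le> (norm (Psi z))\<^sup>2" if "z \<in> M" "z \<notin> ?C" for z
    proof -
      have "R < norm (Psi z)" using that by auto
      then have "R\<^sup>2 \<le> (norm (Psi z))\<^sup>2" by (intro power_mono) (auto simp: R_def)
      then show ?thesis by (simp add: R_def)
    qed
    obtain b where b: "\<And>z. z \<in> ?C \<Longrightarrow> norm z < b"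
      using compact_imp_bounded[OF C] unfolding bounded_pos_less by blast
    have "z \<in> M \<longrightarrow> Z \<le> (norm (Psi z))\<^sup>2" if "b \<le> norm z" for z
      using b[of z] Z[of z] that by linarith
    then have "\<forall>\<^sub>F z in inf at_infinity (principal M). Z \<le> (norm (Psi z))\<^sup>2"
      unfolding eventually_inf_principal eventually_at_infinity by blast
    moreover have "\<forall>\<^sub>F z in at z0 within M. Z \<le> (norm (Psi z))\<^sup>2" if z0: "z0 \<in> frontier M" for z0
    proof -
      have "z0 \<in> - ?C" using z0 M by (auto simp: frontier_def interior_open)
      moreover have "open (- ?C)" using compact_imp_closed[OF C] by (simp add: open_Compl)
      ultimately show ?thesis unfolding eventually_at_topological using Z by blast
    qed
    ultimately show ?thesis by blast
  qed
  then show "lim_bdry_infty M (\<lambda>z. (norm (Psi z))\<^sup>2)"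
    unfolding lim_bdry_infty_def filterlim_at_top by blast
qed

section \<open>Existence, uniqueness and surjectivity for a rotation invariant source\<close>

locale rotation_invariant_kahler =
  fixes M :: "(complex^'n) set" and Phit :: "real^'n \<Rightarrow> real"
  assumes M: "open M" "connected M"
    and axes: "\<exists>z\<in>M. z $ k = 0"
    and rot: "rot_inv_kahler M Phit"
begin

definition P :: "complex^'n \<Rightarrow> real" where "P z = Phit (sqmod z)"

definition f :: "'n \<Rightarrow> complex^'n \<Rightarrow> real" where "f k z = pd Phit k (sqmod z)"

definition E :: "complex^'n \<Rightarrow> real" where "E z = euler_sum Phit (sqmod z)"

lemma E_eq: "E z = (\<Sum>k\<in>UNIV. f k z * (cmod (z $ k))\<^sup>2)"
  by (simp add: E_def euler_sum_def f_def sqmod_def)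

lemma smooth_Phit:
  obtains U where "open U" "sqmod ` M \<subseteq> U" "smooth_on U Phit"
  using rot unfolding rot_inv_kahler_def tildeM_def by blast

lemma kform_pos: "z \<in> M \<Longrightarrow> u \<noteq> 0 \<Longrightarrow> kform P z u (Jmul u) > 0"
  using rot unfolding rot_inv_kahler_def kahler_potential_def P_def[abs_def] by blast

lemma Ck_on_f: "Ck_on j M (f k)"
proof -
  obtain U where U: "open U" "sqmod ` M \<subseteq> U" "smooth_on U Phit" by (rule smooth_Phit)
  have "Ck_on j U (pd Phit k)"
    unfolding pd_def by (rule Ck_on_SucD(2)) (use U(3) in \<open>simp only: smooth_on_def\<close>)
  from Ck_on_compose[OF M(1) U(2) this Ck_on_sqmod[OF M(1)]] show ?thesis
    by (simp add: f_def[abs_def])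
qed

lemma Ck_on_E: "Ck_on j M E"
  unfolding E_eq[abs_def] power2_norm_eq_inner
  by (intro Ck_on_sum Ck_on_mult Ck_on_f Ck_on_inner Ck_on_vec_nth Ck_on_ident M)

lemma toric: "toric_potential M P f"
  unfolding toric_potential_def
proof (intro conjI ballI allI M)
  fix z assume z: "z \<in> M"
  obtain U where U: "open U" "sqmod ` M \<subseteq> U" "smooth_on U Phit" by (rule smooth_Phit)
  let ?D = "frechet_derivative Phit (at (sqmod z))"
  have "(Phit has_derivative ?D) (at (sqmod z))"
    by (rule Ck_on_SucD(1)[of 0 U]) (use U z in \<open>auto simp only: smooth_on_def\<close>)
  then have "(P has_derivative (\<lambda>u. ?D (\<Sum>k\<in>UNIV. axis k (2 * (z $ k \<bullet> u $ k))))) (at z)"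
    unfolding P_def[abs_def] by (rule has_derivative_compose[OF has_derivative_sqmod])
  moreover have "?D (\<Sum>k\<in>UNIV. axis k (2 * (z $ k \<bullet> u $ k))) = (\<Sum>k\<in>UNIV. 2 * f k z * (z $ k \<bullet> u $ k))" for u
  proof -
    have "axis k (2 * (z $ k \<bullet> u $ k)) = (2 * (z $ k \<bullet> u $ k)) *\<^sub>R axis k (1::real)" for k
      by (simp add: axis_def vec_eq_iff)
    moreover have lin: "linear ?D"
      using \<open>(Phit has_derivative ?D) (at (sqmod z))\<close> by (rule has_derivative_linear)
    ultimately show ?thesis by (simp add: linear_sum linear_scale f_def pd_def mult_ac)
  qed
  ultimately show "(P has_derivative (\<lambda>u. \<Sum>k\<in>UNIV. 2 * f k z * (z $ k \<bullet> u $ k))) (at z)" by simp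
  show "f k differentiable at z" for k using Ck_on_f[of "Suc 0" k] z by simp
  show "hess P z u v = hess P z v u" for u v
  proof -
    have "Ck_on 2 M P"
      using rot unfolding rot_inv_kahler_def kahler_potential_def smooth_on_def P_def[abs_def] by blast
    from second_derivative_symmetric[OF M(1) z this] show ?thesis unfolding hess_def .
  qed
qed

lemma f_pos:
  assumes "\<And>z. z \<in> M \<Longrightarrow> f k z \<ge> 0" "z \<in> M"
  shows "f k z > 0"
  by (rule toric_pos_if_nonneg[OF toric assms(2) kform_pos[OF assms(2)] assms(1)])

abbreviation special_immersion :: "real \<Rightarrow> (complex^'n \<Rightarrow> complex^'n) \<Rightarrow> bool" where
  "special_immersion c \<equiv> ssi M P (model_dom c) (model_pot c)"

lemma special_immersion_smooth: "special_immersion c Psi \<Longrightarrow> smooth_on M Psi"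
  by (simp add: ssi_def special_map_def)

text \<open>Treats all targets at once: for c <= 0 the bound on \<open>c * E z\<close> follows from
  the signs of the \<open>f k\<close>, and for c = 1 it is the Fubini-Study condition.\<close>

definition admissible :: "real \<Rightarrow> bool" where
  "admissible c \<longleftrightarrow> (\<forall>z\<in>M. (\<forall>k. f k z \<ge> 0) \<and> c * E z < 1)"

text \<open>With N = 1 + c |Psi|^2 the Hamiltonians give |Psi_k|^2 / N = f_k |z_k|^2. Summing over k
  yields E, hence 1 - c E = 1/N > 0, which eliminates N. The sign of f_k comes from this identity
  where z_k is nonzero, and from positivity of the form elsewhere.\<close>

lemma special_immersion_moment:
  assumes Psi: "special_immersion c Psi" and z: "z \<in> M"
  shows "c * E z < 1" "E z = (norm (Psi z))\<^sup>2 / (1 + c * (norm (Psi z))\<^sup>2)"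
    "(cmod (Psi z $ k))\<^sup>2 = f k z * (cmod (z $ k))\<^sup>2 / (1 - c * E z)" "f k z \<ge> 0"
proof -
  let ?N = "1 + c * (norm (Psi z))\<^sup>2"
  have N: "?N > 0" using Psi z unfolding ssi_def model_dom_def by blast
  have eq: "(cmod (Psi z $ k))\<^sup>2 / ?N = f k z * (cmod (z $ k))\<^sup>2" for k
  proof -
    obtain z0 where "z0 \<in> M" "z0 $ k = 0" using axes by blast
    from special_symplectic_moment[OF toric toric_model_pot M(2) this Psi z] show ?thesis by simp
  qed
  have "(norm (Psi z))\<^sup>2 = (\<Sum>k\<in>UNIV. (cmod (Psi z $ k))\<^sup>2)"
    unfolding norm_vec_def L2_set_def by (simp add: sum_nonneg)
  then show E: "E z = (norm (Psi z))\<^sup>2 / ?N"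
    unfolding E_eq eq[symmetric] by (simp add: sum_divide_distrib)
  have N': "1 - c * E z = 1 / ?N" unfolding E using N by (simp add: field_simps)
  also have "\<dots> > 0" using N by simp
  finally show "c * E z < 1" by simp
  show "(cmod (Psi z $ k))\<^sup>2 = f k z * (cmod (z $ k))\<^sup>2 / (1 - c * E z)"
    unfolding N' eq[symmetric] using N by simp
  show "f k z \<ge> 0"
  proof (cases "z $ k = 0")
    case True
    then show ?thesis
      using toric_pos_if_nth_eq_0[OF toric z True] kform_pos[OF z, of "axis k 1"]
      by (simp add: axis_eq_0_iff)
  next
    case False
    have "f k z * (cmod (z $ k))\<^sup>2 \<ge> 0" unfolding eq[symmetric] using N by simp
    with False show ?thesis by (simp add: zero_le_mult_iff)
  qed
qed

text \<open>The witness scales z_k by the positive root of f_k / (1 - c E), the solution of the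
  moment equations; it is smooth because f_k > 0.\<close>

lemma ex_special_immersion:
  assumes adm: "admissible c"
  shows "\<exists>Psi. special_immersion c Psi"
proof -
  have f0: "f k z > 0" if "z \<in> M" for k z using f_pos adm that unfolding admissible_def by blast
  have E1: "1 - c * E z > 0" if "z \<in> M" for z using adm that unfolding admissible_def by force
  define q where "q k z = f k z * inverse (1 - c * E z)" for k z
  have q0: "q k z > 0" if "z \<in> M" for k z unfolding q_def using f0[OF that] E1[OF that] by simp
  have Ckq: "Ck_on j M (q k)" for j k
  proof -
    have "Ck_on j M (\<lambda>z. 1 + (- c) * E z)"
      by (intro Ck_on_add Ck_on_mult Ck_on_const Ck_on_E M)
    then have "Ck_on j M (\<lambda>z. 1 - c * E z)" by simp
    then have "Ck_on j M (\<lambda>z. inverse (1 - c * E z))"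
      by (rule Ck_on_inverse[OF M(1)]) (use E1 in \<open>rule less_imp_neq[symmetric]\<close>)
    then show ?thesis unfolding q_def[abs_def] by (intro Ck_on_mult Ck_on_f M)
  qed
  define psi where "psi k z = sqrt (q k z)" for k z
  have Ckpsi: "Ck_on j M (psi k)" for j k
    unfolding psi_def[abs_def] using M(1) Ckq q0 by (rule Ck_on_sqrt)
  define Psi where "Psi z = (\<chi> k. complex_of_real (psi k z) * z $ k)" for z
  have CkPsi: "Ck_on j M Psi" for j
  proof (rule Ck_on_vecI[OF M(1)])
    fix k
    have "Ck_on j M (\<lambda>z. psi k z *\<^sub>R z $ k)"
      by (intro Ck_on_scaleR Ckpsi Ck_on_vec_nth Ck_on_ident M)
    then show "Ck_on j M (\<lambda>z. Psi z $ k)" by (simp add: Psi_def scaleR_conv_of_real)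
  qed
  have N: "1 + c * (norm (Psi z))\<^sup>2 = 1 / (1 - c * E z)" if z: "z \<in> M" for z
  proof -
    have "(norm (Psi z))\<^sup>2 = (\<Sum>k\<in>UNIV. q k z * (cmod (z $ k))\<^sup>2)"
      unfolding norm_vec_def L2_set_def Psi_def psi_def using less_imp_le[OF q0[OF z]]
      by (simp add: sum_nonneg norm_mult power_mult_distrib)
    also have "\<dots> = E z / (1 - c * E z)"
      unfolding E_eq q_def sum_divide_distrib by (simp add: divide_inverse mult_ac)
    finally have eq: "(norm (Psi z))\<^sup>2 = E z / (1 - c * E z)" .
    show ?thesis unfolding eq using E1[OF z] by (simp add: field_simps)
  qed
  have dom: "Psi z \<in> model_dom c" if "z \<in> M" for z
    unfolding model_dom_def using N[OF that] E1[OF that] by simp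
  have special: "special_map M Psi"
    unfolding special_map_def
  \<comment> \<open>The factors have to be functions of x = \<open>sqmod z\<close>, so the same
    formula is given in terms of \<open>pd\<close> and \<open>euler_sum\<close>.\<close>
  proof (intro conjI exI[of _ "\<lambda>k x. sqrt (pd Phit k x * inverse (1 - c * euler_sum Phit x))"] ballI)
    show "smooth_on M Psi" using CkPsi by (simp add: smooth_on_def)
  qed (simp add: Psi_def psi_def q_def f_def E_def)
  have diff: "Psi differentiable at z" if "z \<in> M" for z using CkPsi[of "Suc 0"] that by simp
  have sympl: "symplectic_on M P (model_pot c) Psi"
  proof (rule special_symplecticI[OF toric toric_model_pot])
    show "psi k differentiable at z" if "z \<in> M" for z k using Ckpsi[of "Suc 0"] that by simp
    show "f k z = 1 / (1 + c * (norm (Psi z))\<^sup>2) * (psi k z)\<^sup>2" if z: "z \<in> M" for z k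
      using E1[OF z] less_imp_le[OF q0[OF z, of k]] unfolding N[OF z] psi_def by (simp add: q_def)
  qed (use dom diff in \<open>auto simp: Psi_def\<close>)
  have "immersion_on M Psi"
    unfolding immersion_on_def
  proof
    fix z assume z: "z \<in> M"
    let ?D = "frechet_derivative Psi (at z)"
    have lin: "linear ?D" using diff[OF z] by (rule linear_frechet_derivative)
    \<comment> \<open>A nonzero kernel vector u would make the pulled back form vanish on u and
      \<open>Jmul u\<close>, where the source form is positive.\<close>
    have "u = 0" if u: "?D u = 0" for u
    proof (rule ccontr)
      assume "u \<noteq> 0"
      then have "kform (model_pot c) (Psi z) (?D u) (?D (Jmul u)) > 0"
        using kform_pos[OF z] sympl z by (simp add: symplectic_on_def)
      moreover have "frechet_derivative (\<lambda>w :: complex^'n. 1 / (1 + c * (norm w)\<^sup>2)) (at (Psi z)) 0 = 0"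
        using toric_model_pot[of c] dom[OF z] unfolding toric_potential_def
        by (intro linear_0 linear_frechet_derivative) blast
      ultimately show False unfolding toric_kform[OF toric_model_pot dom[OF z]] u by simp
    qed
    then show "inj ?D" using linear_injective_0[OF lin] by blast
  qed
  then have "special_immersion c Psi" unfolding ssi_def using special dom sympl by auto
  then show ?thesis by blast
qed

text \<open>Corresponding components have equal modulus, and their factors are real, so their ratio
  is 1 or -1 off z_k = 0. There it is continuous on a connected set, hence constant; on z_k = 0 both
  components vanish.\<close>

lemma special_immersion_unique:
  assumes Psi: "special_immersion c Psi" and Psi': "special_immersion c Psi'"
  shows "\<exists>eps :: real^'n. (\<forall>j. eps $ j = 1 \<or> eps $ j = - 1) \<and>
    (\<forall>z\<in>M. Psi' z = (\<chi> j. complex_of_real (eps $ j) * Psi z $ j))"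
proof -
  have f0: "f k z > 0" if "z \<in> M" for k z
    using f_pos special_immersion_moment(4)[OF Psi] that by blast
  have E1: "1 - c * E z > 0" if "z \<in> M" for z
    using special_immersion_moment(1)[OF Psi that] by simp
  obtain psi where sp: "\<And>z. z \<in> M \<Longrightarrow> Psi z = (\<chi> j. complex_of_real (psi j (sqmod z)) * z $ j)"
    using Psi unfolding ssi_def special_map_def by blast
  obtain psi' where sp': "\<And>z. z \<in> M \<Longrightarrow> Psi' z = (\<chi> j. complex_of_real (psi' j (sqmod z)) * z $ j)"
    using Psi' unfolding ssi_def special_map_def by blast
  have cont: "continuous_on M Psi" "continuous_on M Psi'"
    using special_immersion_smooth[OF Psi] special_immersion_smooth[OF Psi']
    by (auto intro: Ck_on_imp_continuous_on simp: smooth_on_def)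
  have "\<exists>e::real. (e = 1 \<or> e = - 1) \<and> (\<forall>z\<in>M. Psi' z $ k = complex_of_real e * Psi z $ k)" for k
  proof -
    let ?M = "M - {z. z $ k = 0}"
    define s where "s z = Psi' z $ k / Psi z $ k" for z
    have nz: "Psi z $ k \<noteq> 0" if "z \<in> ?M" for z
      using special_immersion_moment(3)[OF Psi, of z k] that f0[of z k] E1[of z] by auto
    have s: "s z \<in> {1, - 1}" if z: "z \<in> ?M" for z
    proof -
      have "(cmod (Psi' z $ k))\<^sup>2 = (cmod (Psi z $ k))\<^sup>2"
        using special_immersion_moment(3)[OF Psi, of z k] special_immersion_moment(3)[OF Psi', of z k] z by simp
      then have "\<bar>psi' k (sqmod z)\<bar> = \<bar>psi k (sqmod z)\<bar>"
        using z by (simp add: sp sp' norm_mult power_mult_distrib)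
      then have "psi' k (sqmod z) = psi k (sqmod z) \<or> psi' k (sqmod z) = - psi k (sqmod z)"
        by (simp add: abs_eq_iff)
      then show ?thesis using nz[OF z] z by (auto simp: s_def sp sp')
    qed
    have "continuous_on ?M s"
      unfolding s_def using nz by (intro continuous_intros continuous_on_subset[OF cont(1)] continuous_on_subset[OF cont(2)]) auto
    moreover have "finite (s ` ?M)" using s by (rule_tac finite_subset[of _ "{1, - 1}"]) auto
    ultimately have "s constant_on ?M"
      using continuous_finite_range_constant_eq connected_Diff_coordinate_hyperplane[OF M] by blast
    then obtain a where a: "\<And>z. z \<in> ?M \<Longrightarrow> s z = a" unfolding constant_on_def by blast
    \<comment> \<open>The constant a is a complex number; e is the same sign as a real
      number.\<close>
    define e :: real where "e = (if a = - 1 then - 1 else 1)"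
    have "Psi' z $ k = complex_of_real e * Psi z $ k" if "z \<in> M" for z
    proof (cases "z $ k = 0")
      case True
      then show ?thesis using that by (simp add: sp sp')
    next
      case False
      then have "s z = of_real e" using s[of z] a[of z] that by (auto simp: e_def)
      then show ?thesis using nz[of z] False that by (simp add: s_def field_simps)
    qed
    then show ?thesis by (intro exI[of _ e]) (auto simp: e_def)
  qed
  then obtain e where e: "\<And>k. e k = 1 \<or> e k = - 1" "\<And>k z. z \<in> M \<Longrightarrow> Psi' z $ k = complex_of_real (e k) * Psi z $ k"
    by metis
  then show ?thesis by (intro exI[of _ "\<chi> k. e k"]) (simp add: vec_eq_iff)
qed

lemma unique_special_immersion_iff:
  "unique_ssi M P (model_dom c) (model_pot c) \<longleftrightarrow> admissible c"
proof
  assume "unique_ssi M P (model_dom c) (model_pot c)"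
  then obtain Psi where "special_immersion c Psi" unfolding unique_ssi_def by blast
  from special_immersion_moment[OF this] show "admissible c" unfolding admissible_def by blast
next
  assume "admissible c"
  then show "unique_ssi M P (model_dom c) (model_pot c)"
    unfolding unique_ssi_def using ex_special_immersion special_immersion_unique by blast
qed

text \<open>Both sides amount to properness. A continuous inverse maps a compact set onto its
  preimage; conversely an immersion in equal dimensions is a local diffeomorphism, and
  \<open>proper_local_diffeo_bij\<close> applies with base point 0.\<close>

lemma diffeo_iff_lim_bdry_infty:
  assumes "0 \<in> M" and Psi: "special_immersion c Psi"
  shows "diffeo_onto_Cn M Psi \<longleftrightarrow> lim_bdry_infty M (\<lambda>z. (norm (Psi z))\<^sup>2)"
proof -
  have smooth: "smooth_on M Psi" and imm: "\<And>z. z \<in> M \<Longrightarrow> inj (frechet_derivative Psi (at z))"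
    using Psi unfolding ssi_def special_map_def immersion_on_def by auto
  have cont: "continuous_on M Psi"
    using smooth Ck_on_imp_continuous_on unfolding smooth_on_def by blast
  show ?thesis
    unfolding lim_bdry_infty_iff_proper[OF M(1) cont]
  proof (intro iffI allI impI)
    fix K :: "(complex^'n) set"
    assume "diffeo_onto_Cn M Psi" and K: "compact K"
    then obtain g where g: "smooth_on UNIV g" "\<And>z. z \<in> M \<Longrightarrow> g (Psi z) = z" "\<And>w. Psi (g w) = w"
      and bij: "bij_betw Psi M UNIV" unfolding diffeo_onto_Cn_def by blast
    have gM: "g w \<in> M" for w
      using bij g(2) unfolding bij_betw_def by (metis UNIV_I imageE)
    have "{z \<in> M. Psi z \<in> K} = g ` K"
    proof (intro equalityI subsetI)
      fix z assume "z \<in> {z \<in> M. Psi z \<in> K}"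
      then show "z \<in> g ` K" using g(2)[of z] by (intro image_eqI[of _ g "Psi z"]) auto
    qed (auto simp: gM g(3))
    moreover have "continuous_on K g"
      using g(1) Ck_on_imp_continuous_on continuous_on_subset unfolding smooth_on_def by blast
    ultimately show "compact {z \<in> M. Psi z \<in> K}" using K by (simp add: compact_continuous_image)
  next
    assume proper: "\<forall>K. compact K \<longrightarrow> compact {z \<in> M. Psi z \<in> K}"
    have zero: "Psi 0 = 0"
      using special_immersion_moment(3)[OF Psi \<open>0 \<in> M\<close>] by (simp add: vec_eq_iff)
    have "bij_betw Psi M UNIV"
    proof (rule proper_local_diffeo_bij[OF _ M(1) imm])
      show "Ck_on (Suc 0) M Psi" using smooth unfolding smooth_on_def by blast
      show "z = 0" if z: "z \<in> M" and "Psi z = Psi 0" for z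
        unfolding vec_eq_iff
      proof
        fix k
        \<comment> \<open>Psi z = 0 forces f_k |z_k|^2 = 0, so positivity of f_k reduces the fibre
          over 0 to the origin.\<close>
        have "f k z > 0" using f_pos special_immersion_moment(4)[OF Psi] z by blast
        then show "z $ k = 0 $ k"
          using special_immersion_moment(1)[OF Psi z] special_immersion_moment(3)[OF Psi z, of k] that zero
          by simp
      qed
    qed (use proper \<open>0 \<in> M\<close> in auto)
    then show "diffeo_onto_Cn M Psi"
      unfolding diffeo_onto_Cn_def
      using smooth_bij_inverse[OF smooth M(1) imm]
      by (intro conjI exI[of _ "inv_into M Psi"])
        (auto simp: bij_betw_def f_inv_into_f inv_into_f_f)
  qed
qed

end

section \<open>Translation of the boundary limits and conclusion\<close>

text \<open>t / (1 + t) maps [0, infinity) increasingly onto [0, 1). It turns the limit 1 of the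
  Euler sum into growth of |Psi|^2 in the Fubini-Study case.\<close>

lemma filterlim_div_one_plus_iff:
  fixes Y :: "'a \<Rightarrow> real"
  assumes "\<And>x. Y x \<ge> 0"
  shows "((\<lambda>x. Y x / (1 + Y x)) \<longlongrightarrow> 1) F \<longleftrightarrow> filterlim Y at_top F"
proof
  assume lim: "((\<lambda>x. Y x / (1 + Y x)) \<longlongrightarrow> 1) F"
  show "filterlim Y at_top F"
    unfolding filterlim_at_top_gt[of _ _ 0]
  proof (intro allI impI)
    fix Z :: real assume Z: "Z > 0"
    have "\<forall>\<^sub>F x in F. Z / (1 + Z) < Y x / (1 + Y x)"
      by (rule order_tendstoD(1)[OF lim]) (use Z in \<open>simp add: field_simps\<close>)
    then show "\<forall>\<^sub>F x in F. Z \<le> Y x"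
    proof eventually_elim
      case (elim x)
      with Z assms[of x] show ?case by (simp add: field_simps add_pos_nonneg)
    qed
  qed
next
  assume "filterlim Y at_top F"
  then have "filterlim (\<lambda>x. 1 + Y x) at_top F"
    by (intro filterlim_tendsto_add_at_top[OF tendsto_const])
  then have "((\<lambda>x. 1 - inverse (1 + Y x)) \<longlongrightarrow> 1 - 0) F"
    by (intro tendsto_diff tendsto_const tendsto_inverse_0_at_top)
  moreover have "1 - inverse (1 + Y x) = Y x / (1 + Y x)" for x
    using assms[of x] by (simp add: field_simps)
  ultimately show "((\<lambda>x. Y x / (1 + Y x)) \<longlongrightarrow> 1) F" by simp
qed

lemma lim_bdry_cong:
  assumes "\<And>z. z \<in> M \<Longrightarrow> F z = G z"
  shows "lim_bdry M F l \<longleftrightarrow> lim_bdry M G l" "lim_bdry_infty M F \<longleftrightarrow> lim_bdry_infty M G"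
proof -
  have ev: "\<forall>\<^sub>F z in inf at_infinity (principal M). F z = G z" "\<forall>\<^sub>F z in at z0 within M. F z = G z" for z0
    using assms by (simp_all add: eventually_inf_principal eventually_at_filter)
  show "lim_bdry M F l \<longleftrightarrow> lim_bdry M G l"
    unfolding lim_bdry_def using tendsto_cong[OF ev(1)] tendsto_cong[OF ev(2)] by simp
  show "lim_bdry_infty M F \<longleftrightarrow> lim_bdry_infty M G"
    unfolding lim_bdry_infty_def using filterlim_cong[OF refl refl ev(1)] filterlim_cong[OF refl refl ev(2)] by simp
qed

theorem theorem1p1:
  fixes M :: "(complex^'n) set" and Phit :: "real^'n \<Rightarrow> real"
  assumes dom: "open M" "connected M"
    and axes: "\<forall>j. \<exists>z\<in>M. z $ j = 0"
    and rot: "rot_inv_kahler M Phit"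
  defines "Phi \<equiv> (\<lambda>z. Phit (sqmod z))"
  shows
   "(unique_ssi M Phi UNIV flat_pot \<longleftrightarrow> (\<forall>x\<in>tildeM M. \<forall>k. pd Phit k x \<ge> 0))
  \<and> (unique_ssi M Phi (ball 0 1) hyp_pot \<longleftrightarrow> (\<forall>x\<in>tildeM M. \<forall>k. pd Phit k x \<ge> 0))
  \<and> (unique_ssi M Phi UNIV FS_pot \<longleftrightarrow>
       (\<forall>x\<in>tildeM M. (\<forall>k. pd Phit k x \<ge> 0) \<and> euler_sum Phit x < 1))
  \<and> (0 \<in> M \<longrightarrow>
      ((\<forall>x\<in>tildeM M. \<forall>k. pd Phit k x \<ge> 0) \<longrightarrow>
         (\<forall>Psi. ssi M Phi UNIV flat_pot Psi \<longrightarrow>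
            (diffeo_onto_Cn M Psi \<longleftrightarrow>
               (\<forall>x\<in>tildeM M. \<forall>k. pd Phit k x > 0) \<and>
               lim_bdry_infty M (\<lambda>z. euler_sum Phit (sqmod z)))))
    \<and> ((\<forall>x\<in>tildeM M. (\<forall>k. pd Phit k x \<ge> 0) \<and> euler_sum Phit x < 1) \<longrightarrow>
         (\<forall>Psi. ssi M Phi UNIV FS_pot Psi \<longrightarrow>
            (diffeo_onto_Cn M Psi \<longleftrightarrow>
               (\<forall>x\<in>tildeM M. \<forall>k. pd Phit k x > 0) \<and>
               lim_bdry M (\<lambda>z. euler_sum Phit (sqmod z)) 1))))"
proof -
  interpret R: rotation_invariant_kahler M Phit
    by unfold_locales (use dom axes rot in auto)
  have Phi: "Phi = R.P" by (simp add: Phi_def R.P_def[abs_def])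
  have nonneg_E: "R.E z \<ge> 0" if "\<forall>k. R.f k z \<ge> 0" for z
    unfolding R.E_eq using that by (intro sum_nonneg mult_nonneg_nonneg) auto
  \<comment> \<open>For c = 0 and c = -1 the bound c E < 1 comes from E >= 0.\<close>
  have adm: "(\<forall>x\<in>tildeM M. \<forall>k. pd Phit k x \<ge> 0) \<longleftrightarrow> R.admissible 0"
    "(\<forall>x\<in>tildeM M. \<forall>k. pd Phit k x \<ge> 0) \<longleftrightarrow> R.admissible (- 1)"
    "(\<forall>x\<in>tildeM M. (\<forall>k. pd Phit k x \<ge> 0) \<and> euler_sum Phit x < 1) \<longleftrightarrow> R.admissible 1"
    using nonneg_E unfolding R.admissible_def tildeM_def ball_simps R.f_def R.E_def
    by (auto intro: less_le_trans[of "- 1" 0])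
  \<comment> \<open>Positivity of the Kaehler form supplies the strict inequalities in the criteria
    for surjectivity.\<close>
  have pos: "\<forall>x\<in>tildeM M. \<forall>k. pd Phit k x > 0" if "R.admissible c" for c
    using that R.f_pos unfolding R.admissible_def R.f_def tildeM_def ball_simps by blast
  \<comment> \<open>For c = 0 the moment identity reads E = |Psi|^2.\<close>
  have flat: "diffeo_onto_Cn M Psi \<longleftrightarrow> lim_bdry_infty M (\<lambda>z. euler_sum Phit (sqmod z))"
    if "0 \<in> M" "R.special_immersion 0 Psi" for Psi
    unfolding R.diffeo_iff_lim_bdry_infty[OF that]
    by (rule lim_bdry_cong) (simp add: R.special_immersion_moment(2)[OF that(2), unfolded R.E_def])
  have FS: "diffeo_onto_Cn M Psi \<longleftrightarrow> lim_bdry M (\<lambda>z. euler_sum Phit (sqmod z)) 1"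
    if "0 \<in> M" "R.special_immersion 1 Psi" for Psi
  proof -
    \<comment> \<open>For c = 1 the moment identity reads E = |Psi|^2 / (1 + |Psi|^2).\<close>
    have "lim_bdry M (\<lambda>z. euler_sum Phit (sqmod z)) 1 \<longleftrightarrow>
        lim_bdry M (\<lambda>z. (norm (Psi z))\<^sup>2 / (1 + (norm (Psi z))\<^sup>2)) 1"
      by (rule lim_bdry_cong) (simp add: R.special_immersion_moment(2)[OF that(2), unfolded R.E_def])
    also have "\<dots> \<longleftrightarrow> lim_bdry_infty M (\<lambda>z. (norm (Psi z))\<^sup>2)"
      unfolding lim_bdry_def lim_bdry_infty_def by (simp add: filterlim_div_one_plus_iff)
    finally show ?thesis using R.diffeo_iff_lim_bdry_infty[OF that] by simp
  qed
  \<comment> \<open>\<open>adm(1)\<close> and \<open>adm(2)\<close> share their left side, which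
    identifies \<open>R.admissible 0\<close> with \<open>R.admissible (- 1)\<close>.\<close>
  show ?thesis
    using R.unique_special_immersion_iff[of 0] R.unique_special_immersion_iff[of "- 1"]
      R.unique_special_immersion_iff[of 1] flat FS pos
    unfolding Phi model_pot_simps adm(1) adm(3) adm(1)[symmetric, unfolded adm(2)] model_dom_simps
    by blast
qed

end
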